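(* Let ${\sf R}$ be a commutative ring and let $A \in {\sf R}^{n\times n}$. There is an algorithm that computes the adjoint matrix $A^*$ of $A$ using only additions, subtractions and multiplications in ${\sf R}$ (no divisions), and that uses $\tilde{O}(n^3\sqrt{n})$ operations in ${\sf R}$.
   Context: The adjoint (adjugate) matrix $A^*$ is the matrix satisfying $AA^* = A^*A = (\det A) I$; its $(j,i)$ entry equals $\partial \det A / \partial a_{i,j}$ viewed as a polynomial in the entries of $A$. The notation $\tilde{O}(g(n))$ means $O(g(n))$ up to missing factors of the form $\alpha(\log n)^\beta$ for positive real constants $\alpha,\beta$. Operations are counted as arithmetic operations (additions, subtractions, multiplications, and constants from $\mathbb{Z}$) in ${\sf R}$. *)

theory Defs
  imports Complex_Main "Jordan_Normal_Form.Determinant"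
begin

text \<open>Division-free straight-line programs over a commutative ring.
  Registers 0..<k hold the inputs; every instruction performs one ring operation
  (addition, subtraction, multiplication, or producing an integer constant)
  on previously computed registers and appends the result as a new register.\<close>

datatype slp_instr = SAdd nat nat | SSub nat nat | SMul nat nat | SConst int

fun slp_step :: "'a :: comm_ring_1 list \<Rightarrow> slp_instr \<Rightarrow> 'a" where
  "slp_step vs (SAdd i j) = vs ! i + vs ! j"
| "slp_step vs (SSub i j) = vs ! i - vs ! j"
| "slp_step vs (SMul i j) = vs ! i * vs ! j"
| "slp_step vs (SConst c) = of_int c"

definition slp_exec :: "slp_instr list \<Rightarrow> 'a :: comm_ring_1 list \<Rightarrow> 'a list" where
  "slp_exec prog inputs = fold (\<lambda>ins vs. vs @ [slp_step vs ins]) prog inputs"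

fun instr_wf :: "nat \<Rightarrow> slp_instr \<Rightarrow> bool" where
  "instr_wf m (SAdd i j) = (i < m \<and> j < m)"
| "instr_wf m (SSub i j) = (i < m \<and> j < m)"
| "instr_wf m (SMul i j) = (i < m \<and> j < m)"
| "instr_wf m (SConst c) = True"

definition slp_wf :: "nat \<Rightarrow> slp_instr list \<Rightarrow> bool" where
  "slp_wf k prog = (\<forall>t < length prog. instr_wf (k + t) (prog ! t))"

definition mat_inputs :: "nat \<Rightarrow> 'a mat \<Rightarrow> 'a list" where
  "mat_inputs n A = map (\<lambda>k. A $$ (k div n, k mod n)) [0..<n * n]"

definition slp_computes_adj :: "nat \<Rightarrow> slp_instr list \<Rightarrow> (nat \<Rightarrow> nat \<Rightarrow> nat) \<Rightarrow> 'a :: comm_ring_1 itself \<Rightarrow> bool" where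
  "slp_computes_adj n prog out (_ :: 'a itself) \<longleftrightarrow>
     slp_wf (n * n) prog \<and>
     (\<forall>i < n. \<forall>j < n. out i j < n * n + length prog) \<and>
     (\<forall>A :: 'a mat. A \<in> carrier_mat n n \<longrightarrow>
        (\<forall>i < n. \<forall>j < n. slp_exec prog (mat_inputs n A) ! out i j = adj_mat A $$ (i, j)))"

end

theory Submission
  imports Defs "HOL-Computational_Algebra.Formal_Power_Series" "HOL-Library.Function_Algebras"
begin

text \<open>
  The coefficients of \<open>q = det(I - XA)\<close> determine the adjoint, since comparing coefficients in
  \<open>(I - XA) adj(I - XA) = q I\<close> expresses it as a combination of powers of A. To compute \<open>q\<close> as a power
  series, enlarge the leading principal block M of A by \<open>s \<approx> \<surd>n\<close> rows and columns at a time. The determinant changes by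
  the factor det T, where the Schur complement T is an s by s matrix of power series whose
  coefficients are the products \<open>C M\<^sup>l B\<close>; baby steps and giant steps compute these with \<open>n\<^sup>3\<close>
  operations up to logarithms. As T is the identity modulo X, all pivots of T are units, and
  elimination needs \<open>s\<^sup>3\<close> multiplications of power series modulo \<open>X\<^sup>n\<close>. Each of these takes \<open>n\<surd>n\<close> operations
  up to logarithms, by cutting the series into chunks of length s and using that polynomials of
  length s have an integer bilinear multiplication algorithm of almost linear rank.
\<close>

section \<open>Bilinear rank of polynomial multiplication\<close>

text \<open>The block size balances two costs. Up to logarithms, enlarging M costs n^3 however few
  rows are added, since matrix products are schoolbook, so few large steps are wanted; elimination
  in a b by b Schur complement costs b^3 n sqrt(n). Both are n^3 at b = sqrt(n), and the sqrt(n)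
  steps then cost n^3 sqrt(n). The chunk length follows the same rule: the rank counts only products
  of linear forms, while evaluating the forms themselves costs rank times length; at length sqrt(n)
  this matches the naive convolution of chunks.

  The obstacle is the arbitrary ring. Pivots of A need not be units, hence the detour through power
  series, where constant term 1 suffices for inversion without division. Interpolation at integers,
  or transforms of length 2^k, would divide by integers that may be zero in the ring; hence a
  bilinear algorithm with integer coefficients, whose correctness is an identity over the integers
  and so transfers to every commutative ring.\<close>

lemma sum_div_mod:
  fixes f :: "nat \<Rightarrow> nat \<Rightarrow> 'b :: comm_monoid_add"
  shows "(\<Sum>l<a * b. f (l div b) (l mod b)) = (\<Sum>p<a. \<Sum>q<b. f p q)"
proof (induction a)
  case (Suc a)
  have "(\<Sum>l<Suc a * b. f (l div b) (l mod b))
      = (\<Sum>l<a * b. f (l div b) (l mod b)) + (\<Sum>l=a*b..<a*b+b. f (l div b) (l mod b))"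
    using sum.atLeastLessThan_concat[of 0 "a*b" "a*b+b" "\<lambda>l. f (l div b) (l mod b)"]
    by (simp add: atLeast0LessThan add.commute)
  also have "(\<Sum>l=a*b..<a*b+b. f (l div b) (l mod b)) = (\<Sum>q<b. f a q)"
    by (subst sum.atLeastLessThan_shift_0) (auto simp: atLeast0LessThan intro!: sum.cong)
  finally show ?case using Suc by simp
qed simp

text \<open>Multiplication of polynomials of length n has bilinear rank at most r over the integers:
  with r products of linear forms, W recovers every coefficient k of the product.\<close>

definition mult_rank :: "nat \<Rightarrow> nat \<Rightarrow> bool" where
  "mult_rank n r \<longleftrightarrow> (\<exists>U V W :: nat \<Rightarrow> nat \<Rightarrow> int. \<forall>i<n. \<forall>j<n. \<forall>k.
     (\<Sum>l<r. W k l * (U l i * V l j)) = (if i + j = k then 1 else 0))"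

lemma mult_rank_mono:
  assumes "mult_rank n r" "n' \<le> n" "r \<le> r'"
  shows "mult_rank n' r'"
proof -
  obtain U V W :: "nat \<Rightarrow> nat \<Rightarrow> int" where
    *: "\<And>i j k. i < n \<Longrightarrow> j < n \<Longrightarrow> (\<Sum>l<r. W k l * (U l i * V l j)) = (if i + j = k then 1 else 0)"
    using assms(1) unfolding mult_rank_def by blast
  define W' where "W' = (\<lambda>k l. if l < r then W k l else 0)"
  have "(\<Sum>l<r'. W' k l * (U l i * V l j)) = (\<Sum>l<r. W k l * (U l i * V l j))" for i j k
    using assms(3) by (intro sum.mono_neutral_cong_right) (auto simp: W'_def)
  then have "\<forall>i<n'. \<forall>j<n'. \<forall>k. (\<Sum>l<r'. W' k l * (U l i * V l j)) = (if i + j = k then 1 else 0)"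
    using * assms(2) by simp
  then show ?thesis unfolding mult_rank_def by blast
qed

text \<open>Schoolbook multiplication, one product for each pair of coefficients; it settles the
  small cases of \<open>mult_rank_pow2\<close>.\<close>

lemma mult_rank_square: "mult_rank n (n * n)"
proof -
  define U V W :: "nat \<Rightarrow> nat \<Rightarrow> int" where
    "U = (\<lambda>l i. if l div n = i then 1 else 0)" and "V = (\<lambda>l j. if l mod n = j then 1 else 0)" and
    "W = (\<lambda>k l. if l div n + l mod n = k then 1 else 0)"
  have "(\<Sum>l<n*n. W k l * (U l i * V l j)) = (if i + j = k then 1 else 0)" if "i < n" "j < n" for i j k
  proof -
    have "(\<Sum>l<n*n. W k l * (U l i * V l j))
        = (\<Sum>p<n. \<Sum>q<n. (if p + q = k then 1 else 0) * ((if p = i then 1 else 0) * (if q = j then 1 else 0)))"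
      unfolding U_def V_def W_def by (subst sum_div_mod[symmetric]) simp
    also have "\<dots> = (\<Sum>p<n. if p = i then (if p + j = k then 1 else 0) else 0)"
    proof (intro sum.cong refl)
      fix p
      have "(\<Sum>q<n. (if p + q = k then 1 else 0) * ((if p = i then 1 else 0) * (if q = j then 1 else 0)))
          = (\<Sum>q<n. if q = j then (if p = i then (if p + q = k then 1 else 0) else 0) else (0::int))"
        by (intro sum.cong refl) simp
      then show "(\<Sum>q<n. (if p + q = k then 1 else 0) * ((if p = i then 1 else 0) * (if q = j then 1 else 0)))
          = (if p = i then (if p + j = k then 1 else 0) else (0::int))"
        using that by simp
    qed
    also have "\<dots> = (if i + j = k then 1 else 0)" using that by simp
    finally show ?thesis .
  qed
  then show ?thesis unfolding mult_rank_def by blast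
qed

text \<open>Factoring out the smaller power leaves, up to sign, 1 minus a positive power of X, which
  has constant term 1 and so is invertible over any commutative ring.\<close>

lemma fps_X_power_diff_times:
  assumes "i \<noteq> j"
  shows "\<exists>v g. (fps_X ^ i - fps_X ^ j) * g = (fps_X ^ v :: 'a::comm_ring_1 fps)"
proof -
  have *: "\<exists>g. (fps_X ^ i - fps_X ^ j) * g = (fps_X ^ i :: 'a fps)" if "i < j" for i j
  proof -
    define u :: "'a fps" where "u = 1 - fps_X ^ (j - i)"
    have "fps_nth u 0 * 1 = 1" using that by (simp add: u_def)
    then have "u * fps_right_inverse u 1 = 1" by (rule fps_right_inverse)
    moreover have "fps_X ^ i - fps_X ^ j = fps_X ^ i * u"
      using that by (simp add: u_def algebra_simps flip: power_add)
    ultimately show ?thesis by (metis mult.assoc mult.right_neutral)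
  qed
  show ?thesis
  proof (cases "i < j")
    case False
    then obtain g where "(fps_X ^ j - fps_X ^ i) * g = (fps_X ^ j :: 'a fps)"
      using * assms by (metis linorder_neqE_nat)
    then have "(fps_X ^ i - fps_X ^ j) * (- g) = (fps_X ^ j :: 'a fps)" by (simp add: algebra_simps)
    then show ?thesis by blast
  qed (use * in blast)
qed

text \<open>Interpolation at the points \<open>X\<^sup>p\<close>: the polynomial with roots \<open>X\<^sup>j\<close> for all \<open>j \<noteq> e\<close>
  isolates the e-th coefficient, and its value at \<open>X\<^sup>e\<close> is a power of \<open>X\<close> times a unit,
  so that no integer has to be inverted.\<close>

lemma fps_X_power_interpolation:
  assumes "e < K"
  shows "\<exists>v w. \<forall>e'<K. (\<Sum>p<K. w p * fps_X ^ (p * e')) = (if e' = e then fps_X ^ v else 0 :: 'a::idom fps)"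
proof -
  define J where "J = {..<K} - {e}"
  define Q :: "'a fps poly" where "Q = (\<Prod>j\<in>J. [:- (fps_X ^ j), 1:])"
  have "\<exists>v g. (\<Prod>j\<in>J'. fps_X ^ e - fps_X ^ j) * g = (fps_X ^ v :: 'a fps)"
    if "finite J'" "e \<notin> J'" for J'
    using that
  proof (induction J')
    case empty
    show ?case by (intro exI[of _ 0] exI[of _ 1]) simp
  next
    case (insert j J')
    obtain v g where 1: "(\<Prod>j\<in>J'. fps_X ^ e - fps_X ^ j) * g = (fps_X ^ v :: 'a fps)"
      using insert by auto
    obtain v' g' where 2: "(fps_X ^ e - fps_X ^ j) * g' = (fps_X ^ v' :: 'a fps)"
      using fps_X_power_diff_times[of e j] insert by auto
    have "(\<Prod>j\<in>insert j J'. fps_X ^ e - fps_X ^ j) * (g' * g) = (fps_X ^ (v' + v) :: 'a fps)"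
      using insert(1,2) 1[symmetric] 2[symmetric] by (simp add: power_add ac_simps)
    then show ?case by blast
  qed
  then obtain v g where vg: "(\<Prod>j\<in>J. fps_X ^ e - fps_X ^ j) * g = (fps_X ^ v :: 'a fps)"
    unfolding J_def by (metis Diff_iff finite_Diff finite_lessThan insertI1)
  have "degree Q \<le> K - 1"
  proof -
    have "degree Q \<le> (\<Sum>j\<in>J. degree [:- (fps_X ^ j :: 'a fps), 1:])"
      unfolding Q_def by (rule degree_prod_sum_le[of J "\<lambda>j. [:- (fps_X ^ j :: 'a fps), 1:]", unfolded comp_def]) (simp add: J_def)
    also have "\<dots> \<le> K - 1" using assms by (simp add: J_def)
    finally show ?thesis .
  qed
  then have poly_Q: "poly Q y = (\<Sum>p<K. coeff Q p * y ^ p)" for y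
    unfolding poly_altdef using assms
    by (intro sum.mono_neutral_left) (auto simp: coeff_eq_0 not_le)
  \<comment> \<open>The factor \<open>g\<close> turns the value of \<open>Q\<close> at
    \<open>fps_X ^ e\<close> into exactly \<open>fps_X ^ v\<close>; at the other points that value
    is 0 anyway.\<close>
  define w where "w = (\<lambda>p. g * coeff Q p)"
  have "(\<Sum>p<K. w p * fps_X ^ (p * e')) = (if e' = e then fps_X ^ v else 0 :: 'a fps)" if "e' < K" for e'
  proof -
    have "(\<Sum>p<K. w p * fps_X ^ (p * e')) = g * poly Q (fps_X ^ e')"
      unfolding poly_Q w_def sum_distrib_left by (intro sum.cong refl) (simp add: ac_simps flip: power_mult)
    also have "poly Q (fps_X ^ e') = (\<Prod>j\<in>J. fps_X ^ e' - fps_X ^ j)"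
      unfolding Q_def poly_prod by simp
    also have "g * \<dots> = (if e' = e then fps_X ^ v else 0)"
    proof (cases "e' = e")
      case False
      then have "e' \<in> J" "finite J" using that by (auto simp: J_def)
      then have "(\<Prod>j\<in>J. fps_X ^ e' - fps_X ^ j :: 'a fps) = 0" by (intro prod_zero) auto
      with False show ?thesis by simp
    qed (use vg in \<open>simp add: ac_simps\<close>)
    finally show ?thesis .
  qed
  then show ?thesis by blast
qed

text \<open>Read a polynomial of length m h as one of length m in Y with coefficients of length h in X.
  Substituting \<open>X\<^sup>p\<close> for Y with \<open>p < 2 m\<close> raises the length in X only by \<open>2 m\<^sup>2\<close>.\<close>

lemma mult_rank_mult:
  assumes "mult_rank (h + 2 * m * m) r" "h > 0"
  shows "mult_rank (m * h) (2 * m * r)"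
proof -
  obtain U V W :: "nat \<Rightarrow> nat \<Rightarrow> int" where
    UVW: "\<And>i j k. i < h + 2*m*m \<Longrightarrow> j < h + 2*m*m \<Longrightarrow>
      (\<Sum>l<r. W k l * (U l i * V l j)) = (if i + j = k then 1 else 0)"
    using assms(1) unfolding mult_rank_def by blast
  have "\<forall>e. \<exists>v w. e < 2*m \<longrightarrow> (\<forall>e'<2*m. (\<Sum>p<2*m. w p * fps_X ^ (p * e')) = (if e' = e then fps_X ^ v else 0 :: int fps))"
    using fps_X_power_interpolation by blast
  \<comment> \<open>A product of two polynomials of length m in Y has fewer than 2 m coefficients,
    so 2 m points determine it; the weights \<open>w e\<close> extract coefficient e, multiplied by
    \<open>fps_X ^ v e\<close>.\<close>
  then obtain v and w :: "nat \<Rightarrow> nat \<Rightarrow> int fps" where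
    vw: "\<And>e e'. e < 2*m \<Longrightarrow> e' < 2*m \<Longrightarrow> (\<Sum>p<2*m. w e p * fps_X ^ (p * e')) = (if e' = e then fps_X ^ v e else 0)"
    by metis
  \<comment> \<open>Exceeds the degree of every product handed to the smaller algorithm, so the sum
    over \<open>k\<close> in \<open>W'\<close> can stop here.\<close>
  define L where "L = 2 * (h + 2*m*m)"
  \<comment> \<open>Weight of coefficient k of the product at Y = X^p in coefficient t of the
    result. With Y set back to X^h, block e feeds position t through its coefficient
    \<open>t - h * e\<close>, which extraction has shifted by \<open>v e\<close>. Each term reads a
    single coefficient of the series \<open>w e p\<close>, so the weights are integers.\<close>
  define Z where "Z = (\<lambda>t p k. \<Sum>e | e < 2*m \<and> h * e \<le> t. 
    if t - h * e + v e < k then 0 else fps_nth (w e p) (t - h * e + v e - k))"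
  \<comment> \<open>\<open>l div r\<close> is the exponent p of the point and \<open>l mod r\<close>
    the product inside the smaller algorithm; putting X^p for Y moves position i to
    \<open>i mod h + p * (i div h)\<close>.\<close>
  define U' where "U' = (\<lambda>l i. U (l mod r) (i mod h + l div r * (i div h)))"
  define V' where "V' = (\<lambda>l i. V (l mod r) (i mod h + l div r * (i div h)))"
  define W' where "W' = (\<lambda>t l. \<Sum>k<L. Z t (l div r) k * W k (l mod r))"
  have "(\<Sum>l<2*m*r. W' t l * (U' l i * V' l j)) = (if i + j = t then 1 else 0)"
    if ij: "i < m * h" "j < m * h" for i j t
  proof -
    define a a' i0 j0 where "a = i div h" "a' = j div h" "i0 = i mod h" "j0 = j mod h"
    note defs = this
    have lt: "a < m" "a' < m" "i0 < h" "j0 < h"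
      using ij assms(2) by (auto simp: defs less_mult_imp_div_less)
    have small: "i0 + p * a < h + 2*m*m" "j0 + p * a' < h + 2*m*m" if "p < 2*m" for p
    proof -
      have "p * a \<le> 2*m*m" "p * a' \<le> 2*m*m" using that lt by (auto intro!: mult_mono)
      then show "i0 + p * a < h + 2*m*m" "j0 + p * a' < h + 2*m*m" using lt by linarith+
    qed
    define u E where "u = i0 + j0" "E = a + a'"
    note defs2 = this
    have E: "E < 2 * m" using lt by (simp add: defs2)
    have uE: "i0 + p * a + (j0 + p * a') = u + p * E" for p by (simp add: defs2 algebra_simps)
    have ijE: "i + j = h * E + u"
      by (simp add: defs defs2 algebra_simps)
    have "(\<Sum>l<2*m*r. W' t l * (U' l i * V' l j))
      = (\<Sum>p<2*m. \<Sum>q<r. (\<Sum>k<L. Z t p k * W k q) * (U q (i0 + p * a) * V q (j0 + p * a')))"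
      unfolding W'_def U'_def V'_def by (subst sum_div_mod[symmetric]) (simp add: defs)
    also have "\<dots> = (\<Sum>p<2*m. Z t p (u + p * E))"
    proof (intro sum.cong refl)
      fix p assume "p \<in> {..<2*m}"
      then have p: "p < 2*m" by simp
      have "(\<Sum>q<r. (\<Sum>k<L. Z t p k * W k q) * (U q (i0 + p * a) * V q (j0 + p * a')))
          = (\<Sum>k<L. Z t p k * (\<Sum>q<r. W k q * (U q (i0 + p * a) * V q (j0 + p * a'))))"
        unfolding sum_distrib_left sum_distrib_right by (subst sum.swap) (simp add: ac_simps)
      also have "\<dots> = (\<Sum>k<L. if k = u + p * E then Z t p k else 0)"
        using small[OF p] by (intro sum.cong refl) (auto simp: UVW uE)
      also have "\<dots> = Z t p (u + p * E)"
        using small[OF p] uE[of p] by (simp add: L_def)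
      finally show "(\<Sum>q<r. (\<Sum>k<L. Z t p k * W k q) * (U q (i0 + p * a) * V q (j0 + p * a'))) = Z t p (u + p * E)" .
    qed
    also have "\<dots> = (\<Sum>e | e < 2*m \<and> h * e \<le> t. \<Sum>p<2*m. fps_nth (w e p * fps_X ^ (u + p * E)) (t - h * e + v e))"
      unfolding Z_def by (subst sum.swap) (intro sum.cong refl, simp only: fps_X_power_mult_right_nth)
    also have "\<dots> = (\<Sum>e | e < 2*m \<and> h * e \<le> t. if e = E then (if t - h * e = u then 1 else 0) else 0)"
    proof (intro sum.cong refl)
      fix e assume "e \<in> {e. e < 2*m \<and> h * e \<le> t}"
      then have e: "e < 2*m" by simp
      have "(\<Sum>p<2*m. fps_nth (w e p * fps_X ^ (u + p * E)) (t - h * e + v e))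
          = fps_nth (fps_X ^ u * (\<Sum>p<2*m. w e p * fps_X ^ (p * E))) (t - h * e + v e)"
        by (simp add: sum_distrib_left fps_sum_nth power_add ac_simps)
      also have "\<dots> = (if e = E then (if t - h * e = u then 1 else 0) else 0)"
        unfolding vw[OF e E] by (auto simp: fps_X_power_nth simp flip: power_add)
      finally show "(\<Sum>p<2*m. fps_nth (w e p * fps_X ^ (u + p * E)) (t - h * e + v e)) = (if e = E then (if t - h * e = u then 1 else 0) else 0)" .
    qed
    also have "\<dots> = (if i + j = t then 1 else 0)" using E by (auto simp: ijE)
    finally show ?thesis .
  qed
  then show ?thesis unfolding mult_rank_def by blast
qed

text \<open>With m = 2^j and h = 2 m^2 the padding \<open>2 * m * m\<close> merely doubles
  \<open>h\<close>, so \<open>mult_rank_mult\<close> shrinks the exponent k to about 2k/3 while the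
  rank per coefficient grows at most 16-fold. The factor \<open>(k + 1) ^ 10\<close> absorbs this:
  for k >= 40 the ratio of the bases \<open>2 * j + 3\<close> and \<open>k + 1\<close> is at most
  3/4, and 16 * 3^10 <= 4^10. The factor \<open>2 ^ 40\<close> pays for schoolbook multiplication
  below 40.\<close>

lemma mult_rank_pow2: "mult_rank (2 ^ k) (2 ^ 40 * 2 ^ k * (k + 1) ^ 10)"
proof (induction k rule: less_induct)
  case (less k)
  show ?case
  proof (cases "k < 40")
    case True
    then have "(2::nat) ^ k * 2 ^ k \<le> 2 ^ 40 * 2 ^ k" by (intro mult_right_mono power_increasing) auto
    also have "\<dots> \<le> 2 ^ 40 * 2 ^ k * (k + 1) ^ 10" by simp
    finally show ?thesis using mult_rank_mono[OF mult_rank_square order.refl] by blast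
  next
    case False
    \<comment> \<open>Makes \<open>3 * j + 1\<close> lie between \<open>k\<close> and
      \<open>k + 2\<close>, so the length \<open>2 ^ j * 2 ^ (2 * j + 1)\<close> covers
      \<open>2 ^ k\<close> and overshoots by a factor of at most 4.\<close>
    define j where "j = (k + 1) div 3"
    have j: "3 * j \<le> k + 1" "k - 1 \<le> 3 * j" unfolding j_def by linarith+
    have "mult_rank (2 ^ (2 * j + 2)) (2 ^ 40 * 2 ^ (2 * j + 2) * (2 * j + 2 + 1) ^ 10)"
      using j False by (intro less.IH) simp
    moreover have "2 * j + 2 + 1 = 2 * j + 3" by simp
    ultimately have IH: "mult_rank (2 ^ (2 * j + 2)) (2 ^ 40 * 2 ^ (2 * j + 2) * (2 * j + 3) ^ 10)"
      by metis
    have "(2::nat) ^ (2 * j + 2) = 2 ^ (2 * j + 1) + 2 * 2 ^ j * 2 ^ j"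
      by (simp add: power_add mult_2_right mult_2[of j])
    then have "mult_rank (2 ^ j * 2 ^ (2 * j + 1)) (2 * 2 ^ j * (2 ^ 40 * 2 ^ (2 * j + 2) * (2 * j + 3) ^ 10))"
      using IH by (intro mult_rank_mult) simp_all
    moreover have "(2::nat) ^ k \<le> 2 ^ j * 2 ^ (2 * j + 1)"
      using j False unfolding power_add[symmetric] by (intro power_increasing) auto
    moreover have "2 * 2 ^ j * (2 ^ 40 * 2 ^ (2 * j + 2) * (2 * j + 3) ^ 10) \<le> 2 ^ 40 * 2 ^ k * (k + 1) ^ 10"
    proof -
      define X Y where "X = (2 * j + 3) ^ 10" "Y = (k + 1) ^ 10"
      have "4 ^ 10 * X = (4 * (2 * j + 3)) ^ 10" by (simp only: power_mult_distrib X_Y_def)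
      also have "\<dots> \<le> (3 * (k + 1)) ^ 10" using j False by (intro power_mono) auto
      also have "\<dots> = 3 ^ 10 * Y" by (simp only: power_mult_distrib X_Y_def)
      finally have 1: "16 * X \<le> Y" by simp
      have "(2::nat) ^ (3 * j + 3) \<le> 2 ^ (k + 4)" using j by (intro power_increasing) auto
      then have 2: "(2::nat) ^ (3 * j + 3) \<le> 16 * 2 ^ k" by (simp add: power_add)
      have "2 * 2 ^ j * (2 ^ 40 * 2 ^ (2 * j + 2) * X) = 2 ^ 40 * (2 ^ (3 * j + 3) * X)"
      proof -
        have "(2::nat) ^ (3 * j + 3) = 2 * 2 ^ j * 2 ^ (2 * j + 2)" 
          by (simp add: power_add mult_2_right mult_2[of j] numeral_3_eq_3)
        then show ?thesis by simp
      qed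
      also have "\<dots> \<le> 2 ^ 40 * (16 * 2 ^ k * X)"
        using 2 by (intro mult_left_mono mult_right_mono) auto
      also have "\<dots> = 2 ^ 40 * 2 ^ k * (16 * X)" by simp
      also have "\<dots> \<le> 2 ^ 40 * 2 ^ k * Y"
        using 1 by (intro mult_left_mono) auto
      finally show ?thesis unfolding X_Y_def .
    qed
    ultimately show ?thesis by (rule mult_rank_mono)
  qed
qed

section \<open>Schur complements and the adjoint\<close>

lemma det_four_block_one_upper:
  fixes S :: "'a :: comm_ring_1 mat"
  assumes "X \<in> carrier_mat m c" "S \<in> carrier_mat c c"
  shows "det (four_block_mat (1\<^sub>m m) X (0\<^sub>m c m) S) = det S"
  using assms(1)
proof (induction m arbitrary: X)
  case 0
  have "four_block_mat (1\<^sub>m 0) X (0\<^sub>m c 0) S = S"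
    using 0 assms by (intro eq_matI) auto
  then show ?case by simp
next
  case (Suc m)
  define X' where "X' = mat m c (\<lambda>(i,j). X $$ (Suc i, j))"
  define x where "x = mat 1 (m + c) (\<lambda>(i,j). if j < m then 0 else X $$ (0, j - m))"
  have "four_block_mat (1\<^sub>m (Suc m)) X (0\<^sub>m c (Suc m)) S
    = four_block_mat (1\<^sub>m 1) x (0\<^sub>m (m + c) 1) (four_block_mat (1\<^sub>m m) X' (0\<^sub>m c m) S)"
    using Suc.prems assms(2) by (intro eq_matI) (auto simp: X'_def x_def less_Suc_eq_0_disj)
  also have "det \<dots> = det (1\<^sub>m 1 :: 'a mat) * det (four_block_mat (1\<^sub>m m) X' (0\<^sub>m c m) S)"
    using assms(2) by (intro det_four_block_mat_lower_left_zero_col) (auto simp: x_def)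
  also have "\<dots> = det S" using Suc.IH[of X'] by (simp add: X'_def)
  finally show ?case .
qed

lemma det_four_block_one_lower:
  fixes M :: "'a :: comm_ring_1 mat"
  assumes "M \<in> carrier_mat m m" "C \<in> carrier_mat c m"
  shows "det (four_block_mat M (0\<^sub>m m c) C (1\<^sub>m c)) = det M"
  using assms(2)
proof (induction c arbitrary: C)
  case 0
  have "four_block_mat M (0\<^sub>m m 0) C (1\<^sub>m 0) = M"
    using 0 assms by (intro eq_matI) auto
  then show ?case by simp
next
  case (Suc c)
  define C' where "C' = mat c m (\<lambda>(i,j). C $$ (i, j))"
  define x where "x = mat 1 (m + c) (\<lambda>(i,j). if j < m then C $$ (c, j) else 0)"
  have "four_block_mat M (0\<^sub>m m (Suc c)) C (1\<^sub>m (Suc c))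
    = four_block_mat (four_block_mat M (0\<^sub>m m c) C' (1\<^sub>m c)) (0\<^sub>m (m + c) 1) x (1\<^sub>m 1)"
  proof -
    have "j - m < c" "j - m < Suc c" if "m \<le> j" "j < m + c" for j using that by linarith+
    then show ?thesis
      using Suc.prems assms(1) by (intro eq_matI) (auto simp: C'_def x_def less_Suc_eq not_less)
  qed
  also have "det \<dots> = det (four_block_mat M (0\<^sub>m m c) C' (1\<^sub>m c)) * det (1\<^sub>m 1 :: 'a mat)"
    using assms(1) by (intro det_four_block_mat_upper_right_zero_col) (auto simp: x_def)
  also have "\<dots> = det M" using Suc.IH[of C'] by (simp add: C'_def)
  finally show ?case .
qed

text \<open>A solution \<open>X\<close> of \<open>M * X = B\<close> stands in for the inverse of
  \<open>M\<close> times \<open>B\<close>, so \<open>M\<close> need not be invertible: the block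
  matrix is the product of a lower triangular one with diagonal blocks \<open>M\<close>, 1 and an
  upper triangular one with diagonal blocks 1, \<open>D - C * X\<close>.\<close>

lemma det_schur_complement:
  fixes M :: "'a :: comm_ring_1 mat"
  assumes M: "M \<in> carrier_mat m m" and X: "X \<in> carrier_mat m c" and C: "C \<in> carrier_mat c m"
    and D: "D \<in> carrier_mat c c" and B: "M * X = B"
  shows "det (four_block_mat M B C D) = det M * det (D - C * X)"
proof -
  have CX: "C * X \<in> carrier_mat c c" using C X by simp
  have DCX: "D - C * X \<in> carrier_mat c c" using CX by (rule minus_carrier_mat)
  have "four_block_mat M (0\<^sub>m m c) C (1\<^sub>m c) * four_block_mat (1\<^sub>m m) X (0\<^sub>m c m) (D - C * X)
     = four_block_mat (M * 1\<^sub>m m + 0\<^sub>m m c * 0\<^sub>m c m) (M * X + 0\<^sub>m m c * (D - C * X))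
        (C * 1\<^sub>m m + 1\<^sub>m c * 0\<^sub>m c m) (C * X + 1\<^sub>m c * (D - C * X))"
    using M X C D CX by (intro mult_four_block_mat) auto
  also have "\<dots> = four_block_mat M B C D"
  proof (rule cong_four_block_mat)
    show "C * X + 1\<^sub>m c * (D - C * X) = D"
      using C X D CX by (intro eq_matI) (auto simp: left_mult_one_mat[of _ c c])
    show "M * X + 0\<^sub>m m c * (D - C * X) = B"
      using M X by (simp add: B[symmetric] left_mult_zero_mat[OF DCX])
  qed (use M C in auto)
  finally have "det (four_block_mat M B C D)
    = det (four_block_mat M (0\<^sub>m m c) C (1\<^sub>m c)) * det (four_block_mat (1\<^sub>m m) X (0\<^sub>m c m) (D - C * X))"
    using M X C D CX by (subst det_mult[symmetric, of _ "m + c"]) (auto intro!: four_block_carrier_mat)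
  then show ?thesis
    using det_four_block_one_upper[OF X DCX] det_four_block_one_lower[OF M C] by simp
qed

text \<open>Preferred to \<open>XI - A\<close> because it is the identity modulo X: leading blocks
  have determinants with constant term 1, and Schur complements keep this form.\<close>

definition rev_char_mat :: "'a :: comm_ring_1 mat \<Rightarrow> 'a fps mat" where
  "rev_char_mat A = mat (dim_row A) (dim_col A)
     (\<lambda>(i,j). (if i = j then 1 else 0) - fps_X * fps_const (A $$ (i,j)))"

lemma rev_char_mat_carrier [simp]: "A \<in> carrier_mat n m \<Longrightarrow> rev_char_mat A \<in> carrier_mat n m"
  by (auto simp: rev_char_mat_def)

text \<open>The vanishing above degree \<open>k\<close> is carried along for the induction: it
  removes the contribution of the constant part of the new factor.\<close>

lemma fps_nth_prod_linear:
  "fps_nth (\<Prod>i<k. fps_const (x i) + fps_X * fps_const (y i)) k = (\<Prod>i<(k::nat). y i :: 'a :: comm_ring_1)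
   \<and> (\<forall>l>k. fps_nth (\<Prod>i<k. fps_const (x i) + fps_X * fps_const (y i)) l = 0)"
proof (induction k)
  case (Suc k)
  have *: "fps_nth (f * (fps_const a + fps_X * fps_const b)) (Suc l) = fps_nth f (Suc l) * a + fps_nth f l * b"
    for f :: "'a fps" and a b l
    by (simp add: distrib_left mult.assoc[symmetric] fps_mult_fps_X_commute)
  show ?case unfolding prod.lessThan_Suc
  proof (intro conjI allI impI, goal_cases)
    case 1 show ?case using Suc by (simp add: *)
  next
    case (2 l) then show ?case using Suc by (cases l) (simp_all add: *)
  qed
qed (auto simp: fps_one_def)

lemma fps_nth_det_linear:
  fixes X Y :: "'a :: comm_ring_1 mat"
  assumes "Y \<in> carrier_mat k k"
  shows "fps_nth (det (mat k k (\<lambda>(i,j). fps_const (X $$ (i,j)) + fps_X * fps_const (Y $$ (i,j))))) k = det Y"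
proof -
  have sgn: "fps_nth (signof p * f) k = signof p * fps_nth f k" for p and f :: "'a fps"
    by (simp add: sign_def)
  have "(\<Prod>i = 0..<k. mat k k (\<lambda>(i,j). fps_const (X $$ (i,j)) + fps_X * fps_const (Y $$ (i,j))) $$ (i, p i))
    = (\<Prod>i<k. fps_const (X $$ (i,p i)) + fps_X * fps_const (Y $$ (i,p i)))" if "p permutes {0..<k}" for p
    unfolding atLeast0LessThan using permutes_in_image[OF that] by (intro prod.cong) auto
  then show ?thesis
    unfolding det_def'[OF assms] 
    by (subst det_def'[of _ k]) (auto simp: fps_sum_nth sgn fps_nth_prod_linear atLeast0LessThan intro!: sum.cong)
qed

text \<open>An entry of adj(I - XA) is, up to sign, a minor of size n - 1 whose entries are linear
  in X. Its coefficient of degree n - 1 sees only the linear parts, hence is the minor of -A. This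
  is where the adjoint of A becomes visible in that of I - XA.\<close>

lemma fps_nth_adj_rev_char_mat:
  fixes A :: "'a :: comm_ring_1 mat"
  assumes A: "A \<in> carrier_mat n n" and ij: "i < n" "j < n"
  shows "fps_nth (adj_mat (rev_char_mat A) $$ (i,j)) (n - 1) = (-1) ^ (n - 1) * adj_mat A $$ (i,j)"
proof -
  define I where "I = mat_delete (1\<^sub>m n :: 'a mat) j i"
  define Y where "Y = (-1) \<cdot>\<^sub>m mat_delete A j i"
  have Y: "Y \<in> carrier_mat (n - 1) (n - 1)" unfolding Y_def by (intro smult_carrier_mat mat_delete_carrier A)
  have "mat_delete (rev_char_mat A) j i
    = mat (n - 1) (n - 1) (\<lambda>(i,j). fps_const (I $$ (i,j)) + fps_X * fps_const (Y $$ (i,j)))"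
    using A ij by (intro eq_matI) (auto simp: rev_char_mat_def mat_delete_def I_def Y_def simp flip: fps_const_neg)
  then have "fps_nth (det (mat_delete (rev_char_mat A) j i)) (n - 1) = det Y"
    using fps_nth_det_linear[OF Y] by simp
  also have "det Y = (-1) ^ (n - 1) * det (mat_delete A j i)"
    using A by (simp add: Y_def)
  finally have *: "fps_nth (det (mat_delete (rev_char_mat A) j i)) (n - 1) = (-1) ^ (n - 1) * det (mat_delete A j i)" .
  have sgn: "fps_nth (f * (-1) ^ k) l = fps_nth f l * (-1) ^ k" for k l and f :: "'a fps"
    by (cases "even k") simp_all
  show ?thesis
    using A ij by (simp add: adj_mat_def cofactor_def sgn *[simplified] ac_simps rev_char_mat_def[of A, THEN arg_cong[of _ _ dim_row]]
      rev_char_mat_def[of A, THEN arg_cong[of _ _ dim_col]])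
qed

lemma pow_mat_add:
  fixes A :: "'a :: semiring_1 mat"
  assumes "A \<in> carrier_mat n n"
  shows "A ^\<^sub>m (k + l) = A ^\<^sub>m k * A ^\<^sub>m l"
proof (induction l)
  case (Suc l)
  then show ?case using assms
    by (simp add: assoc_mult_mat[of "A ^\<^sub>m k" n n "A ^\<^sub>m l" n A n])
qed (use assms in \<open>simp add: right_mult_one_mat[of _ n]\<close>)

lemma pow_mat_Suc_left:
  fixes A :: "'a :: semiring_1 mat"
  assumes "A \<in> carrier_mat n n"
  shows "A ^\<^sub>m Suc k = A * A ^\<^sub>m k"
  using pow_mat_add[OF assms, of 1 k] assms by simp

text \<open>Comparing coefficients in \<open>(I - XA) adj(I - XA) = det(I - XA) I\<close>.\<close>

lemma fps_nth_adj_rev_char_mat_sum: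
  fixes A :: "'a :: comm_ring_1 mat"
  assumes A: "A \<in> carrier_mat n n" and ij: "i < n" "j < n"
  shows "fps_nth (adj_mat (rev_char_mat A) $$ (i,j)) l
    = (\<Sum>k\<le>l. fps_nth (det (rev_char_mat A)) k * (A ^\<^sub>m (l - k)) $$ (i,j))"
  using ij
proof (induction l arbitrary: i j)
  let ?P = "rev_char_mat A" and ?q = "det (rev_char_mat A)"
  have P: "?P \<in> carrier_mat n n" using A by simp
  have adjc: "adj_mat ?P \<in> carrier_mat n n" using adj_mat(1)[OF P] .
  \<comment> \<open>The identity solved for the adjoint, adj P = X A adj P + q I; the factor X
    lowers the degree and drives the induction on \<open>l\<close>.\<close>
  have eq: "adj_mat ?P $$ (i,j) = fps_X * (\<Sum>k<n. fps_const (A $$ (i,k)) * adj_mat ?P $$ (k,j)) + (if i = j then ?q else 0)"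
    if "i < n" "j < n" for i j
  proof -
    have "(if i = j then ?q else 0) = (?P * adj_mat ?P) $$ (i,j)"
      using that adj_mat(2)[OF P] by simp
    also have "\<dots> = (\<Sum>k<n. ?P $$ (i,k) * adj_mat ?P $$ (k,j))"
      using P adjc that by (simp add: scalar_prod_def atLeast0LessThan del: rev_char_mat_carrier)
    also have "\<dots> = (\<Sum>k<n. (if k = i then adj_mat ?P $$ (k,j) else 0) - fps_X * (fps_const (A $$ (i,k)) * adj_mat ?P $$ (k,j)))"
      using A that by (intro sum.cong) (auto simp: rev_char_mat_def algebra_simps)
    also have "\<dots> = adj_mat ?P $$ (i,j) - fps_X * (\<Sum>k<n. fps_const (A $$ (i,k)) * adj_mat ?P $$ (k,j))"
      using that by (simp add: sum_subtractf sum_distrib_left)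
    finally show ?thesis by (simp add: algebra_simps)
  qed
  {
    case 0
    then show ?case using A by (subst eq) auto
  next
    case (Suc l)
    have "fps_nth (adj_mat ?P $$ (i,j)) (Suc l)
        = (\<Sum>k<n. A $$ (i,k) * fps_nth (adj_mat ?P $$ (k,j)) l) + (if i = j then fps_nth ?q (Suc l) else 0)"
      by (subst eq[OF Suc.prems]) (simp add: fps_sum_nth)
    also have "(\<Sum>k<n. A $$ (i,k) * fps_nth (adj_mat ?P $$ (k,j)) l)
        = (\<Sum>h\<le>l. fps_nth ?q h * (\<Sum>k<n. A $$ (i,k) * (A ^\<^sub>m (l - h)) $$ (k,j)))"
      unfolding sum_distrib_left by (subst sum.swap) (simp add: Suc sum_distrib_left ac_simps)
    also have "\<dots> = (\<Sum>h\<le>l. fps_nth ?q h * (A ^\<^sub>m (Suc l - h)) $$ (i,j))"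
    proof (intro sum.cong refl)
      fix h assume "h \<in> {..l}"
      then have "A ^\<^sub>m (Suc l - h) = A * A ^\<^sub>m (l - h)"
        using pow_mat_Suc_left[OF A] by (simp add: Suc_diff_le)
      then have "(A ^\<^sub>m (Suc l - h)) $$ (i,j) = (\<Sum>k<n. A $$ (i,k) * (A ^\<^sub>m (l - h)) $$ (k,j))"
        using A Suc.prems pow_carrier_mat[OF A, of "l - h"] by (simp add: scalar_prod_def atLeast0LessThan)
      then show "fps_nth ?q h * (\<Sum>k<n. A $$ (i,k) * (A ^\<^sub>m (l - h)) $$ (k,j)) = fps_nth ?q h * (A ^\<^sub>m (Suc l - h)) $$ (i,j)"
        by simp
    qed
    finally show ?case using Suc.prems A by simp
  }
qed

text \<open>Coefficient n - 1 of adj(I - XA) evaluated in two ways. The sign is its own inverse, so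
  it can be moved across without dividing.\<close>

lemma adj_mat_eq_sum_powers:
  fixes A :: "'a :: comm_ring_1 mat"
  assumes "A \<in> carrier_mat n n" "i < n" "j < n"
  shows "adj_mat A $$ (i,j)
    = (-1) ^ (n - 1) * (\<Sum>t<n. fps_nth (det (rev_char_mat A)) (n - 1 - t) * (A ^\<^sub>m t) $$ (i,j))"
proof -
  let ?q = "fps_nth (det (rev_char_mat A))"
  have "adj_mat A $$ (i,j) = (-1) ^ (n - 1) * ((-1) ^ (n - 1) * adj_mat A $$ (i,j))"
    by (simp add: mult.assoc[symmetric] flip: power_mult_distrib)
  also have "(-1) ^ (n - 1) * adj_mat A $$ (i,j) = (\<Sum>k\<le>n-1. ?q k * (A ^\<^sub>m (n - 1 - k)) $$ (i,j))"
    using fps_nth_adj_rev_char_mat[OF assms] fps_nth_adj_rev_char_mat_sum[OF assms, of "n - 1"] by simp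
  also have "\<dots> = (\<Sum>t<n. ?q (n - 1 - t) * (A ^\<^sub>m t) $$ (i,j))"
    using assms by (intro sum.reindex_bij_witness[of _ "\<lambda>k. n - 1 - k" "\<lambda>k. n - 1 - k"]) auto
  finally show ?thesis .
qed

section \<open>Counting ring operations\<close>

text \<open>From the elements S all of T can be computed with at most t ring operations.\<close>

inductive derives :: "'a :: comm_ring_1 set \<Rightarrow> nat \<Rightarrow> 'a set \<Rightarrow> bool" where
  derives_refl: "T \<subseteq> S \<Longrightarrow> derives S t T"
| derives_add_step: "x \<in> S \<Longrightarrow> y \<in> S \<Longrightarrow> derives (insert (x + y) S) t T \<Longrightarrow> derives S (Suc t) T"
| derives_diff_step: "x \<in> S \<Longrightarrow> y \<in> S \<Longrightarrow> derives (insert (x - y) S) t T \<Longrightarrow> derives S (Suc t) T"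
| derives_mult_step: "x \<in> S \<Longrightarrow> y \<in> S \<Longrightarrow> derives (insert (x * y) S) t T \<Longrightarrow> derives S (Suc t) T"
| derives_of_int_step: "derives (insert (of_int c) S) t T \<Longrightarrow> derives S (Suc t) T"

lemma derives_mono:
  assumes "derives S t T" "S \<subseteq> S'" "T' \<subseteq> T" "t \<le> t'"
  shows "derives S' t' T'"
  using assms
proof (induction arbitrary: S' t' rule: derives.induct)
  case (derives_refl T S t)
  then show ?case by (auto intro: derives.derives_refl)
next
  case (derives_add_step x S y t T)
  obtain u where u: "t' = Suc u" "t \<le> u" using derives_add_step.prems by (cases t') auto
  have "derives (insert (x + y) S') u T'" using derives_add_step u by (intro derives_add_step.IH) auto
  then show ?case using derives_add_step u by (auto intro: derives.derives_add_step[of x _ y])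
next
  case (derives_diff_step x S y t T)
  obtain u where u: "t' = Suc u" "t \<le> u" using derives_diff_step.prems by (cases t') auto
  have "derives (insert (x - y) S') u T'" using derives_diff_step u by (intro derives_diff_step.IH) auto
  then show ?case using derives_diff_step u by (auto intro: derives.derives_diff_step[of x _ y])
next
  case (derives_mult_step x S y t T)
  obtain u where u: "t' = Suc u" "t \<le> u" using derives_mult_step.prems by (cases t') auto
  have "derives (insert (x * y) S') u T'" using derives_mult_step u by (intro derives_mult_step.IH) auto
  then show ?case using derives_mult_step u by (auto intro: derives.derives_mult_step[of x _ y])
next
  case (derives_of_int_step c S t T)
  obtain u where u: "t' = Suc u" "t \<le> u" using derives_of_int_step.prems by (cases t') auto
  have "derives (insert (of_int c) S') u T'" using derives_of_int_step u by (intro derives_of_int_step.IH) auto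
  then show ?case using u by (auto intro: derives.derives_of_int_step)
qed

lemma derives_keep: "derives S t T \<Longrightarrow> derives S t (S \<union> T)"
proof (induction rule: derives.induct)
  case (derives_refl T S t)
  then show ?case by (auto intro: derives.derives_refl)
next
  case (derives_add_step x S y t T)
  then show ?case
    by (intro derives.derives_add_step[of x _ y]) (auto intro: derives_mono)
next
  case (derives_diff_step x S y t T)
  then show ?case
    by (intro derives.derives_diff_step[of x _ y]) (auto intro: derives_mono)
next
  case (derives_mult_step x S y t T)
  then show ?case
    by (intro derives.derives_mult_step[of x _ y]) (auto intro: derives_mono)
next
  case (derives_of_int_step c S t T)
  then show ?case
    by (intro derives.derives_of_int_step[of c]) (auto intro: derives_mono)
qed

text \<open>The second stage may read all of \<open>T\<close>, so a shared intermediate result is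
  paid for once; the large cost bounds below are chains of such stages.\<close>

lemma derives_trans:
  assumes "derives S t T" "derives (S \<union> T) u U"
  shows "derives S (t + u) (T \<union> U)"
  using assms
proof (induction rule: derives.induct)
  case (derives_refl T S t)
  then have "derives S u (S \<union> U)" by (simp add: Un_absorb2 derives_keep)
  then show ?case using derives_refl by (auto intro: derives_mono)
next
  case (derives_add_step x S y t T)
  then have "derives (insert (x + y) S) (t + u) (T \<union> U)"
    by (intro derives_add_step.IH) (auto intro: derives_mono)
  then show ?case using derives_add_step(1,2) by (auto intro: derives.derives_add_step[of x _ y])
next
  case (derives_diff_step x S y t T)
  then have "derives (insert (x - y) S) (t + u) (T \<union> U)"
    by (intro derives_diff_step.IH) (auto intro: derives_mono)
  then show ?case using derives_diff_step(1,2) by (auto intro: derives.derives_diff_step[of x _ y])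
next
  case (derives_mult_step x S y t T)
  then have "derives (insert (x * y) S) (t + u) (T \<union> U)"
    by (intro derives_mult_step.IH) (auto intro: derives_mono)
  then show ?case using derives_mult_step(1,2) by (auto intro: derives.derives_mult_step[of x _ y])
next
  case (derives_of_int_step c S t T)
  then have "derives (insert (of_int c) S) (t + u) (T \<union> U)"
    by (intro derives_of_int_step.IH) (auto intro: derives_mono)
  then show ?case by (auto intro: derives.derives_of_int_step)
qed

lemma derives_Un: "derives S t T \<Longrightarrow> derives S u U \<Longrightarrow> derives S (t + u) (T \<union> U)"
  by (rule derives_trans) (auto intro: derives_mono)

lemma derives_UN:
  assumes "finite I" "\<And>i. i \<in> I \<Longrightarrow> derives S t (T i)"
  shows "derives S (card I * t) (\<Union>i\<in>I. T i)"
  using assms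
proof (induction I)
  case (insert i I)
  then have "derives S (t + card I * t) (T i \<union> (\<Union>i\<in>I. T i))" by (intro derives_Un) auto
  then show ?case using insert by simp
qed (simp add: derives_refl)

lemma derives_image:
  assumes "finite I" "\<And>i. i \<in> I \<Longrightarrow> derives S t {f i}"
  shows "derives S (card I * t) (f ` I)"
  using derives_UN[OF assms] by (simp add: UNION_singleton_eq_range)

lemma derives_of_int: "derives S 1 {of_int c}"
  using derives_of_int_step[of c S 0 "{of_int c}"] by (simp add: derives_refl)

lemma derives_add: "derives S t {x} \<Longrightarrow> derives S u {y} \<Longrightarrow> derives S (t + u + 1) {x + y}"
  using derives_trans[OF derives_Un, of S t "{x}" u "{y}" 1 "{x + y}"]
    derives_add_step[of x "S \<union> ({x} \<union> {y})" y 0 "{x + y}"]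
  by (auto intro: derives_mono derives_refl)

lemma derives_diff: "derives S t {x} \<Longrightarrow> derives S u {y} \<Longrightarrow> derives S (t + u + 1) {x - y}"
  using derives_trans[OF derives_Un, of S t "{x}" u "{y}" 1 "{x - y}"]
    derives_diff_step[of x "S \<union> ({x} \<union> {y})" y 0 "{x - y}"]
  by (auto intro: derives_mono derives_refl)

lemma derives_mult: "derives S t {x} \<Longrightarrow> derives S u {y} \<Longrightarrow> derives S (t + u + 1) {x * y}"
  using derives_trans[OF derives_Un, of S t "{x}" u "{y}" 1 "{x * y}"]
    derives_mult_step[of x "S \<union> ({x} \<union> {y})" y 0 "{x * y}"]
  by (auto intro: derives_mono derives_refl)

text \<open>Each term costs \<open>t\<close> and one addition; the final 1 produces the constant 0
  of the empty sum.\<close>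

lemma derives_sum:
  assumes "finite I" "\<And>i. i \<in> I \<Longrightarrow> derives S t {f i}"
  shows "derives S (card I * (t + 1) + 1) {\<Sum>i\<in>I. f i}"
  using assms
proof (induction I)
  case empty
  show ?case using derives_of_int[of S 0] by simp
next
  case (insert i I)
  then have "derives S (t + (card I * (t + 1) + 1) + 1) {f i + (\<Sum>i\<in>I. f i)}"
    by (intro derives_add) auto
  then show ?case using insert by (simp add: ac_simps)
qed

lemma derives_sum_le:
  assumes "finite I" "\<And>i. i \<in> I \<Longrightarrow> derives S t {f i}" "card I * (t + 1) + 1 \<le> u"
  shows "derives S u {\<Sum>i\<in>I. f i}"
  using derives_sum[of I S t f] assms by (auto intro: derives_mono)

lemma derives_mem: "x \<in> S \<Longrightarrow> derives S t {x}"
  by (simp add: derives_refl)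

lemma derives_iterate:
  assumes "\<And>k. k < m \<Longrightarrow> derives (S \<union> (\<Union>i\<le>k. T i)) t (T (Suc k))" "T 0 \<subseteq> S"
  shows "derives S (m * t) (\<Union>i\<le>m. T i)"
  using assms(1)
proof (induction m)
  case 0
  then show ?case using assms(2) by (auto intro: derives_refl)
next
  case (Suc m)
  have "derives S (m * t + t) ((\<Union>i\<le>m. T i) \<union> T (Suc m))"
    using Suc by (intro derives_trans) auto
  then show ?case by (simp add: atMost_Suc Un_commute add.commute)
qed

section \<open>Cost of matrix products, powers and Krylov sequences\<close>

lemma derives_elements_mat:
  assumes "A \<in> carrier_mat r c" "\<And>i j. i < r \<Longrightarrow> j < c \<Longrightarrow> derives S t {A $$ (i,j)}"
  shows "derives S (r * c * t) (elements_mat A)"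
proof -
  have "elements_mat A = (\<lambda>(i,j). A $$ (i,j)) ` ({..<r} \<times> {..<c})"
    using assms(1) by (force simp: elements_mat_def)
  then show ?thesis
    using derives_image[of "{..<r} \<times> {..<c}" S t "\<lambda>(i,j). A $$ (i,j)"] assms(2) by auto
qed

lemma derives_mat_mult:
  assumes A: "A \<in> carrier_mat r k" and B: "B \<in> carrier_mat k c"
    and S: "elements_mat A \<subseteq> S" "elements_mat B \<subseteq> S"
  shows "derives S (r * c * (2 * k + 1)) (elements_mat (A * B))"
proof (rule derives_elements_mat)
  show "A * B \<in> carrier_mat r c" using A B by simp
  fix i j assume ij: "i < r" "j < c"
  have eq: "(A * B) $$ (i,j) = (\<Sum>l<k. A $$ (i,l) * B $$ (l,j))"
    using A B ij by (simp add: scalar_prod_def atLeast0LessThan)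
  have "derives S (0 + 0 + 1) {A $$ (i,l) * B $$ (l,j)}" if "l < k" for l
    using A B ij that S by (intro derives_mult derives_mem) (auto intro: elements_matI)
  then show "derives S (2 * k + 1) {(A * B) $$ (i,j)}"
    unfolding eq by (intro derives_sum_le[where t = 1]) auto
qed

lemma derives_pow_mat_pow2:
  assumes A: "A \<in> carrier_mat n n" and S: "elements_mat A \<subseteq> S"
  shows "derives S (e * (n * n * (2 * n + 1))) (elements_mat (A ^\<^sub>m (2 ^ e)))"
proof -
  have "derives S (e * (n * n * (2 * n + 1))) (\<Union>i\<le>e. elements_mat (A ^\<^sub>m (2 ^ i)))"
  proof (rule derives_iterate)
    fix k
    have "A ^\<^sub>m (2 ^ Suc k) = A ^\<^sub>m (2 ^ k) * A ^\<^sub>m (2 ^ k)"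
      using pow_mat_add[OF A, of "2 ^ k" "2 ^ k"] by (simp add: mult_2)
    then show "derives (S \<union> (\<Union>i\<le>k. elements_mat (A ^\<^sub>m (2 ^ i)))) (n * n * (2 * n + 1)) (elements_mat (A ^\<^sub>m (2 ^ Suc k)))"
      using pow_carrier_mat[OF A] by (simp only:) (intro derives_mat_mult, auto)
  qed (use A S in auto)
  then show ?thesis by (rule derives_mono) auto
qed

text \<open>Each step multiplies \<open>A\<close> into the thin block and never forms the power of
  \<open>A\<close>, so it costs about n^2 c operations instead of n^3.\<close>

lemma derives_krylov_right:
  assumes A: "A \<in> carrier_mat n n" and C: "C \<in> carrier_mat n c"
    and S: "elements_mat A \<subseteq> S" "elements_mat C \<subseteq> S"
  shows "derives S (m * (n * c * (2 * n + 1))) (\<Union>i\<le>m. elements_mat (A ^\<^sub>m i * C))"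
proof (rule derives_iterate)
  fix k
  have eq: "A ^\<^sub>m Suc k * C = A * (A ^\<^sub>m k * C)"
    unfolding pow_mat_Suc_left[OF A] by (rule assoc_mult_mat[OF A _ C]) (use A in simp)
  have "elements_mat (A ^\<^sub>m k * C) \<subseteq> S \<union> (\<Union>i\<le>k. elements_mat (A ^\<^sub>m i * C))" by blast
  then show "derives (S \<union> (\<Union>i\<le>k. elements_mat (A ^\<^sub>m i * C))) (n * c * (2 * n + 1)) (elements_mat (A ^\<^sub>m Suc k * C))"
    unfolding eq using A C S by (intro derives_mat_mult) auto
qed (use A C S in \<open>simp add: left_mult_one_mat[of _ n]\<close>)

lemma derives_krylov_left:
  assumes A: "A \<in> carrier_mat n n" and R: "R \<in> carrier_mat c n"
    and S: "elements_mat A \<subseteq> S" "elements_mat R \<subseteq> S"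
  shows "derives S (m * (n * c * (2 * n + 1))) (\<Union>i\<le>m. elements_mat (R * A ^\<^sub>m i))"
proof (rule derives_iterate)
  fix k
  have eq: "R * A ^\<^sub>m Suc k = (R * A ^\<^sub>m k) * A"
    using A R by (simp add: assoc_mult_mat[of R c n _ n A n])
  have "elements_mat (R * A ^\<^sub>m k) \<subseteq> S \<union> (\<Union>i\<le>k. elements_mat (R * A ^\<^sub>m i))" by blast
  moreover have "R * A ^\<^sub>m k \<in> carrier_mat c n" using A R by simp
  ultimately have "derives (S \<union> (\<Union>i\<le>k. elements_mat (R * A ^\<^sub>m i))) (c * n * (2 * n + 1)) (elements_mat (R * A ^\<^sub>m Suc k))"
    unfolding eq using A R S by (intro derives_mat_mult) auto
  then show "derives (S \<union> (\<Union>i\<le>k. elements_mat (R * A ^\<^sub>m i))) (n * c * (2 * n + 1)) (elements_mat (R * A ^\<^sub>m Suc k))"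
    by (simp add: mult.commute[of c])
qed (use A R S in \<open>simp add: right_mult_one_mat[of _ c]\<close>)

section \<open>Cost of arithmetic with truncated power series\<close>

definition fps_coeffs :: "nat \<Rightarrow> 'a :: comm_ring_1 fps \<Rightarrow> 'a set" where
  "fps_coeffs N f = fps_nth f ` {..<N}"

lemma derives_fps_coeffs:
  assumes "\<And>k. k < N \<Longrightarrow> derives S t {fps_nth f k}"
  shows "derives S (N * t) (fps_coeffs N f)"
  using derives_image[of "{..<N}" S t "fps_nth f"] assms by (simp add: fps_coeffs_def)

text \<open>As a sum over a full square with an indicator, the convolution has independent index
  ranges, so that sums can be exchanged freely.\<close>

lemma sum_diagonal:
  fixes \<phi> :: "nat \<Rightarrow> nat \<Rightarrow> 'b :: comm_monoid_add"
  assumes "e < s"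
  shows "(\<Sum>a\<le>e. \<phi> a (e - a)) = (\<Sum>a<s. \<Sum>a'<s. if a + a' = e then \<phi> a a' else 0)"
proof -
  have "(\<Sum>a'<s. if a + a' = e then \<phi> a a' else 0) = (if a \<le> e then \<phi> a (e - a) else 0)" for a
  proof -
    have "(\<Sum>a'<s. if a + a' = e then \<phi> a a' else 0) = (\<Sum>a'<s. if a' = e - a then (if a \<le> e then \<phi> a a' else 0) else 0)"
      by (intro sum.cong) auto
    moreover have "e - a < s" using assms by simp
    ultimately show ?thesis by simp
  qed
  then have "(\<Sum>a<s. \<Sum>a'<s. if a + a' = e then \<phi> a a' else 0) = (\<Sum>a<s. if a \<le> e then \<phi> a (e - a) else 0)"
    by simp
  also have "\<dots> = (\<Sum>a\<le>e. \<phi> a (e - a))"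
    using assms by (intro sum.mono_neutral_cong_right) auto
  finally show ?thesis by simp
qed

lemma sum_chunks:
  fixes h :: "nat \<Rightarrow> 'b :: comm_monoid_add"
  shows "(\<Sum>u<m * s. h u) = (\<Sum>a<m. \<Sum>i<s. h (s * a + i))"
  using sum_div_mod[of "\<lambda>a i. h (s * a + i)" s m] by simp

text \<open>Split both series into chunks of length s, multiply chunks through the bilinear rank
  decomposition and combine chunks naively.\<close>

lemma derives_fps_mult:
  assumes rank: "mult_rank s r" and s: "0 < s" "s \<le> r"
    and S: "fps_coeffs (s * s) f \<subseteq> S" "fps_coeffs (s * s) g \<subseteq> S"
  shows "derives S (21 * r * s * s) (fps_coeffs (s * s) (f * g))"
proof -
  obtain U V W :: "nat \<Rightarrow> nat \<Rightarrow> int" where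
    UVW: "\<And>i j k. i < s \<Longrightarrow> j < s \<Longrightarrow> (\<Sum>l<r. W k l * (U l i * V l j)) = (if i + j = k then 1 else 0)"
    using rank unfolding mult_rank_def by blast
  define F where "F = (\<lambda>(l,a). \<Sum>i<s. of_int (U l i) * fps_nth f (s * a + i))"
  define G where "G = (\<lambda>(l,a). \<Sum>i<s. of_int (V l i) * fps_nth g (s * a + i))"
  \<comment> \<open>The chunks are convolved on the level of the r products, before \<open>W\<close>
    recombines them. Thus \<open>W\<close> is applied once per block \<open>e\<close> of the result
    and not once per pair of chunks, which saves a factor of s.\<close>
  define H where "H = (\<lambda>(l,e). \<Sum>a\<le>e. F (l,a) * G (l,e - a))"
  define K where "K = (\<lambda>(e,k). \<Sum>l<r. of_int (W k l) * H (l,e))"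
  \<comment> \<open>The blocks that can reach position t: products of chunks have length below 2 s,
    so neighbouring blocks overlap.\<close>
  define E where "E = (\<lambda>t. {e. e < s \<and> s * e \<le> t \<and> t < s * e + 2 * s})"
  have chunk: "s * a + i < s * s" if "a < s" "i < s" for a i
  proof -
    have "s * a + i < s * Suc a" using that by simp
    also have "\<dots> \<le> s * s" using that by (intro mult_left_mono) auto
    finally show ?thesis .
  qed
  have dF: "derives S (r * s * (4 * s)) (F ` ({..<r} \<times> {..<s}))"
  proof -
    have "derives S (4 * s) {F (l,a)}" if "l < r" "a < s" for l a
      unfolding F_def prod.case
    proof (rule derives_sum_le)
      fix i assume "i \<in> {..<s}"
      then show "derives S (1 + 0 + 1) {of_int (U l i) * fps_nth f (s * a + i)}"
        using that S chunk[of a i] by (intro derives_mult derives_of_int derives_mem) (auto simp: fps_coeffs_def)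
    qed (use s in auto)
    then show ?thesis using derives_image[of "{..<r} \<times> {..<s}" S "4 * s" F] by (auto simp: card_cartesian_product)
  qed
  have dG: "derives S (r * s * (4 * s)) (G ` ({..<r} \<times> {..<s}))"
  proof -
    have "derives S (4 * s) {G (l,a)}" if "l < r" "a < s" for l a
      unfolding G_def prod.case
    proof (rule derives_sum_le)
      fix i assume "i \<in> {..<s}"
      then show "derives S (1 + 0 + 1) {of_int (V l i) * fps_nth g (s * a + i)}"
        using that S chunk[of a i] by (intro derives_mult derives_of_int derives_mem) (auto simp: fps_coeffs_def)
    qed (use s in auto)
    then show ?thesis using derives_image[of "{..<r} \<times> {..<s}" S "4 * s" G] by (auto simp: card_cartesian_product)
  qed
  define S1 where "S1 = F ` ({..<r} \<times> {..<s}) \<union> G ` ({..<r} \<times> {..<s})"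
  have dS1: "derives S (8 * r * s * s) S1"
    using derives_Un[OF dF dG] unfolding S1_def by (rule derives_mono) auto
  have dH: "derives (S \<union> S1) (r * s * (3 * s)) (H ` ({..<r} \<times> {..<s}))"
  proof -
    have "derives (S \<union> S1) (3 * s) {H (l,e)}" if "l < r" "e < s" for l e
      unfolding H_def prod.case
    proof (rule derives_sum_le)
      fix a assume "a \<in> {..e}"
      then have "F (l,a) \<in> S1" "G (l,e-a) \<in> S1" using that by (auto simp: S1_def)
      then show "derives (S \<union> S1) (0 + 0 + 1) {F (l,a) * G (l,e-a)}"
        by (intro derives_mult derives_mem) auto
    qed (use that in auto)
    then show ?thesis using derives_image[of "{..<r} \<times> {..<s}" "S \<union> S1" "3 * s" H] by (auto simp: card_cartesian_product)
  qed
  define S2 where "S2 = S1 \<union> H ` ({..<r} \<times> {..<s})"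
  have dS2: "derives S (11 * r * s * s) S2"
    using derives_trans[OF dS1 dH] unfolding S2_def by (rule derives_mono) auto
  have dK: "derives (S \<union> S2) (s * (2 * s) * (4 * r)) (K ` ({..<s} \<times> {..<2*s}))"
  proof -
    have "derives (S \<union> S2) (4 * r) {K (e,k)}" if "e < s" "k < 2 * s" for e k
      unfolding K_def prod.case
    proof (rule derives_sum_le)
      fix l assume "l \<in> {..<r}"
      then show "derives (S \<union> S2) (1 + 0 + 1) {of_int (W k l) * H (l,e)}"
        using that by (intro derives_mult derives_of_int derives_mem) (auto simp: S2_def)
    qed (use s in auto)
    then show ?thesis using derives_image[of "{..<s} \<times> {..<2*s}" "S \<union> S2" "4 * r" K] by (auto simp: card_cartesian_product)
  qed
  define S3 where "S3 = S2 \<union> K ` ({..<s} \<times> {..<2*s})"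
  have dS3: "derives S (19 * r * s * s) S3"
    using derives_trans[OF dS2 dK] unfolding S3_def by (rule derives_mono) (auto simp: algebra_simps)
  have coeff: "fps_nth (f * g) t = (\<Sum>e\<in>E t. K (e, t - s * e))" if t: "t < s * s" for t
  proof -
    have K: "K (e, k) = (\<Sum>a<s. \<Sum>a'<s. if a + a' = e then
        (\<Sum>i<s. \<Sum>i'<s. if i + i' = k then fps_nth f (s * a + i) * fps_nth g (s * a' + i') else 0) else 0)"
      if "e < s" for e k
    proof -
      have *: "(\<Sum>l<r. of_int (W k l) * (F (l,a) * G (l,a')))
        = (\<Sum>i<s. \<Sum>i'<s. if i + i' = k then fps_nth f (s * a + i) * fps_nth g (s * a' + i') else 0)" for a a'
      proof -
        have "(\<Sum>l<r. of_int (W k l) * (F (l,a) * G (l,a')))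
          = (\<Sum>l<r. \<Sum>i<s. \<Sum>i'<s. of_int (W k l * (U l i * V l i')) * (fps_nth f (s * a + i) * fps_nth g (s * a' + i')))"
          unfolding F_def G_def prod.case sum_product unfolding sum_distrib_left by (simp add: ac_simps)
        also have "\<dots> = (\<Sum>i<s. \<Sum>i'<s. of_int (\<Sum>l<r. W k l * (U l i * V l i')) * (fps_nth f (s * a + i) * fps_nth g (s * a' + i')))"
          unfolding of_int_sum sum_distrib_right
          by (rule trans[OF sum.swap], rule sum.cong[OF refl], rule sum.swap)
        also have "\<dots> = (\<Sum>i<s. \<Sum>i'<s. if i + i' = k then fps_nth f (s * a + i) * fps_nth g (s * a' + i') else 0)"
          by (intro sum.cong refl) (simp add: UVW)
        finally show ?thesis .
      qed
      have "K (e, k) = (\<Sum>a\<le>e. \<Sum>l<r. of_int (W k l) * (F (l,a) * G (l,e - a)))"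
        unfolding K_def H_def prod.case sum_distrib_left by (rule sum.swap)
      also have "\<dots> = (\<Sum>a<s. \<Sum>a'<s. if a + a' = e then (\<Sum>l<r. of_int (W k l) * (F (l,a) * G (l,a'))) else 0)"
        by (rule sum_diagonal[OF that])
      finally show ?thesis by (simp only: *)
    qed
    have "(\<Sum>e\<in>E t. K (e, t - s * e))
        = (\<Sum>e\<in>E t. \<Sum>a<s. \<Sum>a'<s. \<Sum>i<s. \<Sum>i'<s. if a + a' = e \<and> i + i' = t - s * e
              then fps_nth f (s * a + i) * fps_nth g (s * a' + i') else 0)"
      by (intro sum.cong refl) (auto simp: K E_def intro!: sum.cong)
    also have "\<dots> = (\<Sum>a<s. \<Sum>a'<s. \<Sum>i<s. \<Sum>i'<s. \<Sum>e\<in>E t. if a + a' = e \<and> i + i' = t - s * e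
              then fps_nth f (s * a + i) * fps_nth g (s * a' + i') else 0)"
      by (rule trans[OF sum.swap], rule sum.cong[OF refl], rule trans[OF sum.swap], rule sum.cong[OF refl],
          rule trans[OF sum.swap], rule sum.cong[OF refl], rule sum.swap)
    also have "\<dots> = (\<Sum>a<s. \<Sum>a'<s. \<Sum>i<s. \<Sum>i'<s. if s * a + i + (s * a' + i') = t
              then fps_nth f (s * a + i) * fps_nth g (s * a' + i') else 0)"
    proof (intro sum.cong refl)
      fix a a' i i' assume "a \<in> {..<s}" "a' \<in> {..<s}" "i \<in> {..<s}" "i' \<in> {..<s}"
      then have lt: "i < s" "i' < s" by auto
      let ?x = "fps_nth f (s * a + i) * fps_nth g (s * a' + i')"
      have iff: "(a + a' \<in> E t \<and> i + i' = t - s * (a + a')) \<longleftrightarrow> s * a + i + (s * a' + i') = t"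
      proof
        assume "s * a + i + (s * a' + i') = t"
        then have eq: "t = s * (a + a') + (i + i')" by (simp add: algebra_simps)
        then have "s * (a + a') < s * s" using t by linarith
        then show "a + a' \<in> E t \<and> i + i' = t - s * (a + a')" using eq lt by (auto simp: E_def)
      qed (auto simp: E_def algebra_simps)
      have "(\<Sum>e\<in>E t. if a + a' = e \<and> i + i' = t - s * e then ?x else 0)
          = (\<Sum>e\<in>E t. if e = a + a' then (if i + i' = t - s * (a + a') then ?x else 0) else 0)"
        by (intro sum.cong) auto
      also have "\<dots> = (if a + a' \<in> E t \<and> i + i' = t - s * (a + a') then ?x else 0)"
        by (subst sum.delta) (auto simp: E_def)
      finally show "(\<Sum>e\<in>E t. if a + a' = e \<and> i + i' = t - s * e then ?x else 0)
          = (if s * a + i + (s * a' + i') = t then ?x else 0)"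
        unfolding iff .
    qed
    also have "\<dots> = (\<Sum>a<s. \<Sum>i<s. \<Sum>a'<s. \<Sum>i'<s. if s * a + i + (s * a' + i') = t
              then fps_nth f (s * a + i) * fps_nth g (s * a' + i') else 0)"
      by (rule sum.cong[OF refl], rule sum.swap)
    also have "\<dots> = (\<Sum>u<s*s. \<Sum>v<s*s. if u + v = t then fps_nth f u * fps_nth g v else 0)"
      by (simp only: sum_chunks)
    also have "\<dots> = (\<Sum>u\<le>t. fps_nth f u * fps_nth g (t - u))"
      by (rule sum_diagonal[symmetric, OF t])
    finally show ?thesis by (simp add: fps_mult_nth atLeast0AtMost)
  qed
  have "derives (S \<union> S3) (s * s * (2 * s)) (fps_coeffs (s * s) (f * g))"
  proof (rule derives_fps_coeffs)
    fix t assume t: "t < s * s"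
    have "finite (E t)" "card (E t) \<le> s"
      using card_mono[of "{..<s}" "E t"] by (auto simp: E_def)
    then show "derives (S \<union> S3) (2 * s) {fps_nth (f * g) t}"
      unfolding coeff[OF t] using s
      by (intro derives_sum_le[where t = 0] derives_mem) (auto simp: S3_def E_def)
  qed
  \<comment> \<open>In units of \<open>r * s * s\<close>: 4 each for \<open>F\<close> and
    \<open>G\<close>, 3 for \<open>H\<close>, 8 for \<open>K\<close> and 2 for adding the
    overlapping blocks.\<close>
  from derives_trans[OF dS3 this] show ?thesis
  proof (rule derives_mono)
    have "s * s * (2 * s) \<le> s * s * (2 * r)" using s by (intro mult_left_mono) auto
    then show "19 * r * s * s + s * s * (2 * s) \<le> 21 * r * s * s" by (simp add: algebra_simps)
  qed auto
qed

text \<open>The recurrence for the coefficients divides only by the constant term, which is 1. Its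
  quadratic cost is affordable because elimination inverts one series per pivot.\<close>

lemma derives_fps_inverse:
  assumes ab: "a * b = 1" and a0: "fps_nth a 0 = 1" and S: "fps_coeffs N a \<subseteq> S"
  shows "derives S (N * (2 * N + 3)) (fps_coeffs N b)"
proof -
  have b0: "fps_nth b 0 = 1" using arg_cong[OF ab, of "\<lambda>f. fps_nth f 0"] a0 by simp
  have b: "fps_nth b k = 0 - (\<Sum>i=1..k. fps_nth a i * fps_nth b (k - i))" if "k > 0" for k
  proof -
    have "0 = fps_nth (a * b) k" using ab that by simp
    also have "\<dots> = fps_nth b k + (\<Sum>i=1..k. fps_nth a i * fps_nth b (k - i))"
      unfolding fps_mult_nth by (subst sum.atLeast_Suc_atMost) (simp_all add: a0)
    finally show ?thesis by (simp add: eq_neg_iff_add_eq_0)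
  qed
  have "derives S (N * (2 * N + 3)) (\<Union>i\<le>N. fps_nth b ` {..<i})"
  proof (rule derives_iterate)
    fix k assume k: "k < N"
    let ?S = "S \<union> (\<Union>i\<le>k. fps_nth b ` {..<i})"
    have "derives ?S (2 * N + 3) {fps_nth b k}"
    proof (cases "k = 0")
      case True
      then show ?thesis using b0 by (intro derives_mono[OF derives_of_int[of ?S 1]]) auto
    next
      case False
      have *: "derives ?S (1 + (2 * k + 1) + 1) {0 - (\<Sum>i=1..k. fps_nth a i * fps_nth b (k - i))}"
      proof (intro derives_diff)
        show "derives ?S 1 {0}" using derives_of_int[of ?S 0] by simp
        show "derives ?S (2 * k + 1) {\<Sum>i=1..k. fps_nth a i * fps_nth b (k - i)}"
        proof (rule derives_sum_le)
          fix i assume i: "i \<in> {1..k}"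
          have "fps_nth a i \<in> ?S" using S k i by (auto simp: fps_coeffs_def)
          moreover have "fps_nth b (k - i) \<in> ?S" using i by auto
          ultimately show "derives ?S (0 + 0 + 1) {fps_nth a i * fps_nth b (k - i)}"
            by (intro derives_mult derives_mem)
        qed auto
      qed
      show ?thesis using b[of k] False k by (intro derives_mono[OF *]) auto
    qed
    then have "derives ?S (2 * N + 3) (?S \<union> {fps_nth b k})" by (rule derives_keep)
    then show "derives ?S (2 * N + 3) (fps_nth b ` {..<Suc k})"
      by (rule derives_mono) (auto simp: lessThan_Suc)
  qed auto
  then show ?thesis by (rule derives_mono) (auto simp: fps_coeffs_def)
qed

lemma derives_fps_coeffs_diff:
  assumes "fps_coeffs N f \<subseteq> S" "fps_coeffs N g \<subseteq> S"
  shows "derives S N (fps_coeffs N (f - g))"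
proof -
  have "derives S (N * (0 + 0 + 1)) (fps_coeffs N (f - g))"
    using assms
    by (intro derives_fps_coeffs, unfold fps_sub_nth, intro derives_diff derives_mem) (auto simp: fps_coeffs_def)
  then show ?thesis by simp
qed

text \<open>Gaussian elimination as a sequence of Schur complements of 1 by 1 blocks. Entries of the
  pivot column below the pivot have constant term 0, so the remaining matrix \<open>T'\<close> is
  again the identity modulo X and its pivots are units without any row exchange.\<close>

lemma derives_det_fps:
  fixes T :: "'a :: comm_ring_1 fps mat"
  assumes rank: "mult_rank s r" and s: "0 < s" "s \<le> r"
    and T: "T \<in> carrier_mat c c" and c: "c \<le> s"
    and T0: "\<And>i j. i < c \<Longrightarrow> j < c \<Longrightarrow> fps_nth (T $$ (i,j)) 0 = (if i = j then 1 else 0)"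
    and S: "\<And>i j. i < c \<Longrightarrow> j < c \<Longrightarrow> fps_coeffs (s * s) (T $$ (i,j)) \<subseteq> S" "{0,1} \<subseteq> S"
  shows "derives S (c * (27 * r * s ^ 4)) (fps_coeffs (s * s) (det T))"
  using T c T0 S
proof (induction c arbitrary: T S)
  case 0
  have "det T = 1" using 0(1) by (simp add: det_dim_zero)
  moreover have "fps_coeffs (s * s) 1 \<subseteq> S" using 0(5) by (auto simp: fps_coeffs_def fps_one_nth)
  ultimately show ?case by (simp add: derives_refl)
next
  case (Suc c)
  define N where "N = s * s"
  define a where "a = T $$ (0,0)"
  define b where "b = fps_right_inverse a 1"
  have a0: "fps_nth a 0 = 1" using Suc.prems(3)[of 0 0] by (simp add: a_def)
  then have ab: "a * b = 1" unfolding b_def by (intro fps_right_inverse) simp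
  define M where "M = mat 1 1 (\<lambda>_. a)"
  define B where "B = mat 1 c (\<lambda>(i,j). T $$ (0, Suc j))"
  define C where "C = mat c 1 (\<lambda>(i,j). T $$ (Suc i, 0))"
  define D where "D = mat c c (\<lambda>(i,j). T $$ (Suc i, Suc j))"
  define X where "X = mat 1 c (\<lambda>(i,j). b * T $$ (0, Suc j))"
  define T' where "T' = D - C * X"
  have T: "T = four_block_mat M B C D"
    using Suc.prems(1) by (intro eq_matI) (auto simp: M_def B_def C_def D_def a_def less_Suc_eq_0_disj)
  have "M * X = B"
    by (intro eq_matI) (auto simp: M_def B_def X_def scalar_prod_def mult.assoc[symmetric] ab)
  then have "det T = det M * det T'"
    unfolding T T'_def by (intro det_schur_complement[of _ 1 _ c]) (auto simp: M_def B_def X_def C_def D_def)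
  then have detT: "det T = a * det T'" by (simp add: M_def det_single)
  have T'c: "T' \<in> carrier_mat c c" by (simp add: T'_def D_def C_def X_def minus_mat_def)
  have T': "T' $$ (i,j) = T $$ (Suc i, Suc j) - T $$ (Suc i, 0) * (b * T $$ (0, Suc j))" if "i < c" "j < c" for i j
    using that by (simp add: T'_def D_def C_def X_def scalar_prod_def)
  define S1 where "S1 = fps_coeffs N b"
  define S2 where "S2 = (\<Union>j<c. fps_coeffs N (b * T $$ (0, Suc j)))"
  define S3 where "S3 = (\<Union>(i,j)\<in>{..<c}\<times>{..<c}. fps_coeffs N (T $$ (Suc i, 0) * (b * T $$ (0, Suc j))))"
  define S4 where "S4 = (\<Union>(i,j)\<in>{..<c}\<times>{..<c}. fps_coeffs N (T' $$ (i, j)))"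
  have TS: "fps_coeffs N (T $$ (i,j)) \<subseteq> S" if "i < Suc c" "j < Suc c" for i j
    using Suc.prems(4)[OF that] by (simp add: N_def)
  have d1: "derives S (N * (2 * N + 3)) S1"
    unfolding S1_def using TS[of 0 0] by (intro derives_fps_inverse[OF ab a0]) (simp add: a_def)
  have d2: "derives (S \<union> S1) (card {..<c} * (21 * r * s * s)) S2"
    unfolding S2_def N_def
  proof (intro derives_UN derives_fps_mult rank s)
    fix j assume "j \<in> {..<c}"
    then show "fps_coeffs (s * s) (T $$ (0, Suc j)) \<subseteq> S \<union> S1" using TS[of 0 "Suc j"] by (auto simp: N_def)
  qed (auto simp: S1_def N_def)
  have d3: "derives (S \<union> (S1 \<union> S2)) (card ({..<c} \<times> {..<c}) * (21 * r * s * s)) S3"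
    unfolding S3_def N_def
  proof (intro derives_UN, simp, clarify, intro derives_fps_mult rank s)
    fix i j assume "i < c" "j < c"
    then show "fps_coeffs (s * s) (T $$ (Suc i, 0)) \<subseteq> S \<union> (S1 \<union> S2)"
      "fps_coeffs (s * s) (b * T $$ (0, Suc j)) \<subseteq> S \<union> (S1 \<union> S2)"
      using TS[of "Suc i" 0] by (auto simp: N_def S2_def)
  qed
  have d4: "derives (S \<union> (S1 \<union> S2 \<union> S3)) (card ({..<c} \<times> {..<c}) * N) S4"
    unfolding S4_def
  proof (intro derives_UN, simp, clarify)
    fix i j assume ij: "i < c" "j < c"
    then show "derives (S \<union> (S1 \<union> S2 \<union> S3)) N (fps_coeffs N (T' $$ (i, j)))"
      unfolding T'[OF ij] using TS[of "Suc i" "Suc j"]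
      by (intro derives_fps_coeffs_diff) (auto simp: S3_def)
  qed
  have d5: "derives (S \<union> (S1 \<union> S2 \<union> S3 \<union> S4)) (c * (27 * r * s ^ 4)) (fps_coeffs N (det T'))"
    unfolding N_def
  proof (rule Suc.IH)
    fix i j assume ij: "i < c" "j < c"
    then show "fps_nth (T' $$ (i, j)) 0 = (if i = j then 1 else 0)"
      using Suc.prems(3)[of "Suc i" "Suc j"] Suc.prems(3)[of "Suc i" 0] by (simp add: T')
    show "fps_coeffs (s * s) (T' $$ (i, j)) \<subseteq> S \<union> (S1 \<union> S2 \<union> S3 \<union> S4)"
      using ij by (auto simp: S4_def N_def)
  qed (use T'c Suc.prems in auto)
  have d6: "derives (S \<union> (S1 \<union> S2 \<union> S3 \<union> S4 \<union> fps_coeffs N (det T'))) (21 * r * s * s) (fps_coeffs N (det T))"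
    unfolding detT N_def using TS[of 0 0]
    by (intro derives_fps_mult rank s) (auto simp: N_def a_def)
  note d = derives_trans[OF derives_trans[OF derives_trans[OF derives_trans[OF derives_trans[OF d1 d2] d3] d4] d5] d6]
  define Q where "Q = 21 * r * s * s"
  \<comment> \<open>Unit of account for one pivot: \<open>21 * K\<close> for at most s^2 series
    products, \<open>K\<close> for the subtractions, \<open>5 * K\<close> for the inversion;
    together 27.\<close>
  define K where "K = r * s ^ 4"
  have "c * c + c + 1 \<le> s * s"
  proof -
    have "c * c + c + 1 \<le> Suc c * Suc c" by simp
    also have "\<dots> \<le> s * s" using Suc.prems(2) by (intro mult_mono) auto
    finally show ?thesis .
  qed
  then have "(c * c + c + 1) * Q \<le> (s * s) * Q" by (rule mult_right_mono) simp
  also have "(s * s) * Q = 21 * K" by (simp add: K_def Q_def power4_eq_xxxx)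
  finally have c1: "c * c * Q + c * Q + Q \<le> 21 * K" by (simp add: algebra_simps)
  have NK: "s * s * N \<le> K" using s by (simp add: N_def K_def power4_eq_xxxx)
  have "c * c * N \<le> s * s * N" using Suc.prems(2) by (intro mult_mono) auto
  then have c2: "c * c * N \<le> K" using NK by linarith
  have "N * (2 * N + 3) \<le> N * (5 * N)" using s by (intro mult_left_mono) (auto simp: N_def)
  also have "\<dots> = 5 * (s * s * N)" by (simp add: N_def)
  finally have c3: "N * (2 * N + 3) \<le> 5 * K" using NK by linarith
  have "27 * r * s ^ 4 = 27 * K" by (simp add: K_def)
  then have cost: "N * (2 * N + 3) + card {..<c} * (21 * r * s * s) + card ({..<c} \<times> {..<c}) * (21 * r * s * s)
      + card ({..<c} \<times> {..<c}) * N + c * (27 * r * s ^ 4) + 21 * r * s * s \<le> Suc c * (27 * r * s ^ 4)"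
    unfolding card_cartesian_product card_lessThan Q_def[symmetric] mult_Suc using c1 c2 c3 by linarith
  show ?case
    by (rule derives_mono[OF d]) (use cost in \<open>auto simp: N_def\<close>)
qed

section \<open>Cost of det(I - XA) and of the adjoint\<close>

lemma pow_mat_mult:
  fixes A :: "'a :: semiring_1 mat"
  assumes "A \<in> carrier_mat n n"
  shows "(A ^\<^sub>m k) ^\<^sub>m l = A ^\<^sub>m (k * l)"
proof (induction l)
  case (Suc l)
  have "A ^\<^sub>m (k * Suc l) = A ^\<^sub>m (k * l) * A ^\<^sub>m k"
    using pow_mat_add[OF assms, of "k * l" k] by (simp add: add.commute)
  then show ?case using Suc by simp
qed (use assms in simp)

text \<open>Write x for \<open>fps_X\<close>. The off-diagonal blocks of I - xA are -xB and -xC, and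
  (I - xM) X = -xB is solved by the Neumann series, X being minus the sum of x^(l+1) M^l B. The
  Schur complement is therefore I - xD minus the sum of x^(l+2) C M^l B, whence the shift by 2 in
  \<open>T\<close>.\<close>

lemma rev_char_mat_four_block_schur:
  fixes M :: "'a :: comm_ring_1 mat"
  assumes M: "M \<in> carrier_mat m m" and B: "B \<in> carrier_mat m c"
    and C: "C \<in> carrier_mat c m" and D: "D \<in> carrier_mat c c"
  defines "T \<equiv> mat c c (\<lambda>(i,j). Abs_fps (\<lambda>l. if l = 0 then (if i = j then 1 else 0)
    else if l = 1 then - D $$ (i,j) else - (C * (M ^\<^sub>m (l - 2) * B)) $$ (i,j)))"
  shows "det (rev_char_mat (four_block_mat M B C D)) = det (rev_char_mat M) * det T"
proof -
  define nX :: "'a mat \<Rightarrow> 'a fps mat" where "nX = map_mat (\<lambda>x. - (fps_X * fps_const x))"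
  define X where "X = mat m c (\<lambda>(i,j). Abs_fps (\<lambda>l. if l = 0 then 0 else - (M ^\<^sub>m (l - 1) * B) $$ (i,j)))"
  have nX: "nX B \<in> carrier_mat m c" "nX C \<in> carrier_mat c m" using B C by (auto simp: nX_def)
  have Xc: "X \<in> carrier_mat m c" by (simp add: X_def)
  have *: "rev_char_mat (four_block_mat M B C D) = four_block_mat (rev_char_mat M) (nX B) (nX C) (rev_char_mat D)"
    using M B C D by (intro eq_matI) (auto simp: rev_char_mat_def nX_def)
  have Mpow: "M ^\<^sub>m l * B \<in> carrier_mat m c" for l
    by (rule mult_carrier_mat[OF pow_carrier_mat[OF M] B])
  have "rev_char_mat M * X = nX B"
  proof (rule eq_matI)
    fix i j assume "i < dim_row (nX B)" "j < dim_col (nX B)"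
    then have ij: "i < m" "j < c" using B by (auto simp: nX_def)
    have "(rev_char_mat M * X) $$ (i,j) = (\<Sum>k<m. (if k = i then X $$ (k,j) else 0) - fps_X * (fps_const (M $$ (i,k)) * X $$ (k,j)))"
      using M ij Xc by (auto simp: scalar_prod_def atLeast0LessThan rev_char_mat_def algebra_simps intro!: sum.cong)
    also have "\<dots> = X $$ (i,j) - fps_X * (\<Sum>k<m. fps_const (M $$ (i,k)) * X $$ (k,j))"
      using ij by (simp add: sum_subtractf sum_distrib_left)
    also have "\<dots> = nX B $$ (i,j)"
    proof (rule fps_ext)
      fix l
      consider "l = 0" | "l = 1" | k where "l = Suc (Suc k)" by (metis One_nat_def not0_implies_Suc)
      then show "fps_nth (X $$ (i,j) - fps_X * (\<Sum>k<m. fps_const (M $$ (i,k)) * X $$ (k,j))) l = fps_nth (nX B $$ (i,j)) l"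
      proof cases
        case 3
        have "(M ^\<^sub>m Suc k * B) $$ (i,j) = (M * (M ^\<^sub>m k * B)) $$ (i,j)"
          unfolding pow_mat_Suc_left[OF M] using assoc_mult_mat[OF M pow_carrier_mat[OF M] B] by simp
        also have "\<dots> = (\<Sum>h<m. M $$ (i,h) * (M ^\<^sub>m k * B) $$ (h,j))"
          using M Mpow[of k] ij B by (simp add: scalar_prod_def atLeast0LessThan del: index_mult_mat(1) add: index_mult_mat(1)[of i M j])
        finally show ?thesis using 3 ij B
          by (simp add: X_def nX_def fps_sum_nth sum_negf del: index_mult_mat(1) pow_mat.simps)
      qed (use ij B M in \<open>auto simp: X_def nX_def fps_sum_nth left_mult_one_mat[of _ m] simp del: index_mult_mat(1)\<close>)
    qed
    finally show "(rev_char_mat M * X) $$ (i,j) = nX B $$ (i,j)" .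
  qed (use M B in \<open>auto simp: rev_char_mat_def nX_def X_def\<close>)
  then have "det (rev_char_mat (four_block_mat M B C D)) = det (rev_char_mat M) * det (rev_char_mat D - nX C * X)"
    unfolding * using M D nX Xc by (intro det_schur_complement) auto
  also have "rev_char_mat D - nX C * X = T"
  proof (rule eq_matI)
    fix i j assume "i < dim_row T" "j < dim_col T"
    then have ij: "i < c" "j < c" by (auto simp: T_def)
    have "(nX C * X) $$ (i,j) = - (fps_X * (\<Sum>k<m. fps_const (C $$ (i,k)) * X $$ (k,j)))"
      using C ij Xc by (simp add: scalar_prod_def atLeast0LessThan nX_def sum_distrib_left sum_negf mult.assoc)
    then have eq: "(rev_char_mat D - nX C * X) $$ (i,j)
        = rev_char_mat D $$ (i,j) + fps_X * (\<Sum>k<m. fps_const (C $$ (i,k)) * X $$ (k,j))"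
      using C ij Xc nX by simp
    show "(rev_char_mat D - nX C * X) $$ (i,j) = T $$ (i,j)"
    proof (rule fps_ext)
      fix l
      consider "l = 0" | "l = 1" | k where "l = Suc (Suc k)" by (metis One_nat_def not0_implies_Suc)
      then show "fps_nth ((rev_char_mat D - nX C * X) $$ (i,j)) l = fps_nth (T $$ (i,j)) l"
        unfolding eq
      proof cases
        case 3
        have "(C * (M ^\<^sub>m k * B)) $$ (i,j) = (\<Sum>h<m. C $$ (i,h) * (M ^\<^sub>m k * B) $$ (h,j))"
          using C M Mpow[of k] ij B by (simp add: scalar_prod_def atLeast0LessThan del: index_mult_mat(1) add: index_mult_mat(1)[of i C j])
        then show "fps_nth (rev_char_mat D $$ (i,j) + fps_X * (\<Sum>k<m. fps_const (C $$ (i,k)) * X $$ (k,j))) l = fps_nth (T $$ (i,j)) l"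
          using 3 ij D
          by (simp add: X_def T_def rev_char_mat_def fps_sum_nth sum_negf del: index_mult_mat(1) pow_mat.simps)
      qed (use ij D in \<open>auto simp: X_def T_def rev_char_mat_def fps_sum_nth simp del: index_mult_mat(1)\<close>)
    qed
  qed (use C X_def nX in \<open>auto simp: T_def\<close>)
  finally show ?thesis .
qed

text \<open>The products \<open>C M\<^sup>l B\<close> for \<open>l < s\<^sup>2\<close> are obtained by baby steps \<open>M\<^sup>i B\<close> and
  giant steps \<open>C (M\<^sup>s)\<^sup>j\<close>; one shared power \<open>M\<^sup>s\<close> serves all c new rows and columns.\<close>

lemma derives_det_rev_char_mat_step:
  fixes M :: "'a :: comm_ring_1 mat"
  assumes rank: "mult_rank s r" and s: "s = 2 ^ e" "s \<le> r"
    and M: "M \<in> carrier_mat m m" and B: "B \<in> carrier_mat m c"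
    and C: "C \<in> carrier_mat c m" and D: "D \<in> carrier_mat c c"
    and c: "c \<le> s" and m: "m \<le> s * s"
    and S: "elements_mat M \<subseteq> S" "elements_mat B \<subseteq> S" "elements_mat C \<subseteq> S" "elements_mat D \<subseteq> S"
      "{0,1} \<subseteq> S" "fps_coeffs (s * s) (det (rev_char_mat M)) \<subseteq> S"
  shows "derives S ((3 * e + 59) * (r * s ^ 5)) (fps_coeffs (s * s) (det (rev_char_mat (four_block_mat M B C D))))"
proof -
  define T where "T = mat c c (\<lambda>(i,j). Abs_fps (\<lambda>l. if l = 0 then (if i = j then 1 else 0)
    else if l = 1 then - D $$ (i,j) else - (C * (M ^\<^sub>m (l - 2) * B)) $$ (i,j)))"
  define P where "P = M ^\<^sub>m s"
  have P: "P \<in> carrier_mat m m" using M by (simp add: P_def)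
  have s0: "0 < s" using s by simp
  define S1 where "S1 = elements_mat P"
  define S2 where "S2 = (\<Union>i\<le>s. elements_mat (M ^\<^sub>m i * B))"
  define S3 where "S3 = (\<Union>i\<le>s. elements_mat (C * P ^\<^sub>m i))"
  define S4 where "S4 = (\<Union>(j,i)\<in>{..<s}\<times>{..<s}. elements_mat ((C * P ^\<^sub>m j) * (M ^\<^sub>m i * B)))"
  define S5 where "S5 = (\<Union>(i,j)\<in>{..<c}\<times>{..<c}. fps_coeffs (s * s) (T $$ (i,j)))"
  have d1: "derives S (e * (m * m * (2 * m + 1))) S1"
    unfolding S1_def P_def s(1) by (rule derives_pow_mat_pow2[OF M S(1)])
  have d2: "derives (S \<union> S1) (s * (m * c * (2 * m + 1))) S2"
    unfolding S2_def using S by (intro derives_krylov_right M B) auto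
  have d3: "derives (S \<union> (S1 \<union> S2)) (s * (m * c * (2 * m + 1))) S3"
    unfolding S3_def using S by (intro derives_krylov_left P C) (auto simp: S1_def)
  have d4: "derives (S \<union> (S1 \<union> S2 \<union> S3)) (card ({..<s} \<times> {..<s}) * (c * c * (2 * m + 1))) S4"
    unfolding S4_def
  proof (intro derives_UN, simp, clarify)
    fix j i assume "j < s" "i < s"
    then show "derives (S \<union> (S1 \<union> S2 \<union> S3)) (c * c * (2 * m + 1)) (elements_mat ((C * P ^\<^sub>m j) * (M ^\<^sub>m i * B)))"
      using P C M B by (intro derives_mat_mult) (auto simp: S2_def S3_def)
  qed
  have CMB: "(C * (M ^\<^sub>m l * B)) $$ (i,j) \<in> S4" if "l < s * s" "i < c" "j < c" for l i j
  proof -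
    define u v where "u = l div s" "v = l mod s"
    note uv_def = this
    have uv: "u < s" "v < s" using that s0 by (auto simp: uv_def less_mult_imp_div_less)
    have "M ^\<^sub>m l = P ^\<^sub>m u * M ^\<^sub>m v"
      unfolding P_def pow_mat_mult[OF M] pow_mat_add[OF M, symmetric] by (simp add: uv_def)
    then have "C * (M ^\<^sub>m l * B) = C * (P ^\<^sub>m u * (M ^\<^sub>m v * B))"
      using assoc_mult_mat[of "P ^\<^sub>m u" m m "M ^\<^sub>m v" m B c] P M B by simp
    also have "\<dots> = (C * P ^\<^sub>m u) * (M ^\<^sub>m v * B)"
      by (rule assoc_mult_mat[symmetric, OF C pow_carrier_mat[OF P] mult_carrier_mat[OF pow_carrier_mat[OF M] B]])
    finally have "(C * (M ^\<^sub>m l * B)) $$ (i,j) \<in> elements_mat ((C * P ^\<^sub>m u) * (M ^\<^sub>m v * B))"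
      using C P M B that by (intro elements_matI[of _ c c i j]) auto
    then show ?thesis using uv by (auto simp: S4_def)
  qed
  have d5: "derives (S \<union> (S1 \<union> S2 \<union> S3 \<union> S4)) (card ({..<c} \<times> {..<c}) * (s * s * 2)) S5"
    unfolding S5_def
  proof (intro derives_UN, simp, clarify, rule derives_fps_coeffs)
    fix i j l assume ij: "i < c" "j < c" and l: "l < s * s"
    let ?S = "S \<union> (S1 \<union> S2 \<union> S3 \<union> S4)"
    have neg: "derives ?S 2 {- x}" if "x \<in> ?S" for x
    proof -
      have "derives ?S (0 + 0 + 1) {0 - x}"
        using that S(5) by (intro derives_diff derives_mem) auto
      then show ?thesis by (rule derives_mono) auto
    qed
    have "fps_nth (T $$ (i,j)) l = (if l = 0 then (if i = j then 1 else 0)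
        else if l = 1 then - D $$ (i,j) else - (C * (M ^\<^sub>m (l - 2) * B)) $$ (i,j))"
      using ij by (simp add: T_def)
    moreover have "D $$ (i,j) \<in> S" using S(4) D ij by (auto intro: elements_matI)
    moreover have "(C * (M ^\<^sub>m (l - 2) * B)) $$ (i,j) \<in> S4" using l ij by (intro CMB) auto
    ultimately show "derives ?S 2 {fps_nth (T $$ (i,j)) l}"
      using S(5) neg[of "D $$ (i,j)"] neg[of "(C * (M ^\<^sub>m (l - 2) * B)) $$ (i,j)"]
      by (simp add: derives_mem del: index_mult_mat(1))
  qed
  have d6: "derives (S \<union> (S1 \<union> S2 \<union> S3 \<union> S4 \<union> S5)) (c * (27 * r * s ^ 4)) (fps_coeffs (s * s) (det T))"
  proof (rule derives_det_fps[OF rank s0 s(2) _ c])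
    show "T \<in> carrier_mat c c" by (simp add: T_def)
    fix i j assume "i < c" "j < c"
    then show "fps_nth (T $$ (i,j)) 0 = (if i = j then 1 else 0)"
      "fps_coeffs (s * s) (T $$ (i,j)) \<subseteq> S \<union> (S1 \<union> S2 \<union> S3 \<union> S4 \<union> S5)"
      by (auto simp: T_def S5_def)
  qed (use S in auto)
  have d7: "derives (S \<union> (S1 \<union> S2 \<union> S3 \<union> S4 \<union> S5 \<union> fps_coeffs (s * s) (det T))) (21 * r * s * s)
      (fps_coeffs (s * s) (det (rev_char_mat (four_block_mat M B C D))))"
    unfolding rev_char_mat_four_block_schur[OF M B C D, folded T_def]
    using S by (intro derives_fps_mult rank s s0) auto
  note d = derives_trans[OF derives_trans[OF derives_trans[OF derives_trans[OF derives_trans[OF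
      derives_trans[OF d1 d2] d3] d4] d5] d6] d7]
  have m1: "2 * m + 1 \<le> 3 * (s * s)"
  proof -
    have "1 \<le> s * s" using s0 by simp
    then show ?thesis using m by linarith
  qed
  have s6: "s ^ 6 \<le> r * s ^ 5" using s by (simp add: power_numeral_reduce)
  have "m * m * (2 * m + 1) \<le> (s * s) * (s * s) * (3 * (s * s))"
    using m m1 by (intro mult_mono) auto
  also have "\<dots> = 3 * s ^ 6" by (simp add: power_numeral_reduce)
  also have "\<dots> \<le> 3 * (r * s ^ 5)" using s6 by simp
  finally have "e * (m * m * (2 * m + 1)) \<le> e * (3 * (r * s ^ 5))" by (rule mult_left_mono) simp
  then have c1: "e * (m * m * (2 * m + 1)) \<le> (3 * e) * (r * s ^ 5)" by (simp add: ac_simps)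
  have "s * (m * c * (2 * m + 1)) \<le> s * ((s * s) * s * (3 * (s * s)))"
    using m m1 c by (intro mult_mono) auto
  also have "\<dots> = 3 * s ^ 6" by (simp add: power_numeral_reduce)
  finally have c2: "s * (m * c * (2 * m + 1)) \<le> 3 * (r * s ^ 5)" using s6 by simp
  have "s * s * (c * c * (2 * m + 1)) \<le> s * s * (s * s * (3 * (s * s)))"
    using m1 c by (intro mult_mono) auto
  also have "\<dots> = 3 * s ^ 6" by (simp add: power_numeral_reduce)
  finally have c4: "s * s * (c * c * (2 * m + 1)) \<le> 3 * (r * s ^ 5)" using s6 by simp
  have "c * c * (s * s * 2) \<le> s * s * (s * s * 2)" using c by (intro mult_mono) auto
  also have "\<dots> = 2 * s ^ 4" by (simp add: power_numeral_reduce)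
  also have "s ^ 4 \<le> s ^ 6" using s0 by (intro power_increasing) auto
  finally have c5: "c * c * (s * s * 2) \<le> 2 * (r * s ^ 5)" using s6 by simp
  have "c * (27 * r * s ^ 4) \<le> s * (27 * r * s ^ 4)" using c by (rule mult_right_mono) simp
  also have "\<dots> = 27 * (r * s ^ 5)" using power_Suc[of s 4] by simp
  finally have c6: "c * (27 * r * s ^ 4) \<le> 27 * (r * s ^ 5)" .
  have "s ^ 2 \<le> s ^ 5" using s0 by (intro power_increasing) auto
  then have c7: "21 * r * s * s \<le> 21 * (r * s ^ 5)" by (simp add: power2_eq_square)
  \<comment> \<open>In units of \<open>r * s ^ 5\<close>: 3 e for squaring up to
    \<open>M ^\<^sub>m s\<close>, 3 each for the baby steps, the giant steps and their products, 2
    for the signs, 27 for elimination and 21 for the last series product.\<close>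
  have "e * (m * m * (2 * m + 1)) + s * (m * c * (2 * m + 1)) + s * (m * c * (2 * m + 1)) +
      card ({..<s} \<times> {..<s}) * (c * c * (2 * m + 1)) + card ({..<c} \<times> {..<c}) * (s * s * 2) +
      c * (27 * r * s ^ 4) + 21 * r * s * s \<le> (3 * e) * (r * s ^ 5) + 59 * (r * s ^ 5)"
    unfolding card_cartesian_product card_lessThan using c1 c2 c4 c5 c6 c7 by linarith
  then show ?thesis
    by (intro derives_mono[OF d]) (auto simp only: distrib_right)
qed

lemma derives_det_rev_char_mat:
  fixes A :: "'a :: comm_ring_1 mat"
  assumes rank: "mult_rank s r" and s: "s = 2 ^ e" "s \<le> r"
    and A: "A \<in> carrier_mat n n" and n: "n \<le> s * s"
    and S: "elements_mat A \<subseteq> S" "{0,1} \<subseteq> S"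
  shows "derives S ((3 * e + 59) * (r * s ^ 6)) (fps_coeffs (s * s) (det (rev_char_mat A)))"
proof -
  define lead where "lead = (\<lambda>k. mat k k (\<lambda>(i,j). A $$ (i,j)))"
  \<comment> \<open>Since \<open>n <= s * s\<close>, block size n is reached after at most s steps;
    \<open>min\<close> makes any further step add an empty block.\<close>
  define T where "T = (\<lambda>k. fps_coeffs (s * s) (det (rev_char_mat (lead (min (k * s) n)))))"
  have AS: "A $$ (i,j) \<in> S" if "i < n" "j < n" for i j
    using A S(1) that by (auto intro: elements_matI)
  have "derives S (s * ((3 * e + 59) * (r * s ^ 5))) (\<Union>i\<le>s. T i)"
  proof (rule derives_iterate)
    have "det (rev_char_mat (lead (min (0 * s) n))) = 1"
      by (rule det_dim_zero) (simp add: rev_char_mat_def lead_def)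
    then show "T 0 \<subseteq> S" using S(2) by (auto simp: T_def fps_coeffs_def fps_one_nth)
  next
    fix k
    define m where "m = min (k * s) n"
    define c where "c = min (Suc k * s) n - m"
    have c: "c \<le> s" "m + c = min (Suc k * s) n" "m + c \<le> n" "m \<le> s * s"
      using n by (auto simp: c_def m_def)
    define B where "B = mat m c (\<lambda>(i,j). A $$ (i, m + j))"
    define C where "C = mat c m (\<lambda>(i,j). A $$ (m + i, j))"
    define D where "D = mat c c (\<lambda>(i,j). A $$ (m + i, m + j))"
    have eq: "lead (min (Suc k * s) n) = four_block_mat (lead m) B C D"
      unfolding c(2)[symmetric] by (intro eq_matI) (auto simp: lead_def B_def C_def D_def)
    show "derives (S \<union> (\<Union>i\<le>k. T i)) ((3 * e + 59) * (r * s ^ 5)) (T (Suc k))"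
      unfolding T_def eq
    proof (rule derives_det_rev_char_mat_step[OF rank s])
      show "fps_coeffs (s * s) (det (rev_char_mat (lead m)))
          \<subseteq> S \<union> (\<Union>i\<le>k. fps_coeffs (s * s) (det (rev_char_mat (lead (min (i * s) n)))))"
        by (auto simp: m_def)
    qed (use c S(2) in \<open>auto simp: lead_def B_def C_def D_def intro!: AS dest!: elements_matD\<close>)
  qed
  moreover have "T s = fps_coeffs (s * s) (det (rev_char_mat A))"
  proof -
    have "lead n = A" using A by (intro eq_matI) (auto simp: lead_def)
    then show ?thesis using n by (simp add: T_def min_absorb2)
  qed
  moreover have "s * ((3 * e + 59) * (r * s ^ 5)) = (3 * e + 59) * (r * s ^ 6)"
    using power_Suc[of s 5] by (simp add: ac_simps del: power_Suc)
  ultimately have "derives S ((3 * e + 59) * (r * s ^ 6)) (\<Union>i\<le>s. T i)"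
    "fps_coeffs (s * s) (det (rev_char_mat A)) \<subseteq> (\<Union>i\<le>s. T i)" by auto
  then show ?thesis by (rule derives_mono[OF _ order.refl _ order.refl])
qed

text \<open>Evaluating a polynomial of degree below s^2 at the matrix A, split as the sum over j of
  (A^s)^j R_j with R_j of degree below s in A, takes about 3 s matrix products instead of
  s^2.\<close>

lemma derives_adj_mat_from_det:
  fixes A :: "'a :: comm_ring_1 mat"
  assumes A: "A \<in> carrier_mat n n" and n: "n \<le> s * s" and s: "0 < s"
    and S: "elements_mat A \<subseteq> S" "{0,1} \<subseteq> S" "fps_coeffs (s * s) (det (rev_char_mat A)) \<subseteq> S"
  shows "derives S (16 * s ^ 7) (elements_mat (adj_mat A))"
proof -
  \<comment> \<open>Padding with zeros beyond n fills up the range \<open>s * s\<close>, so that it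
    splits evenly into s groups of s.\<close>
  define q where "q = (\<lambda>t. if t < n then fps_nth (det (rev_char_mat A)) (n - 1 - t) else 0)"
  have q: "q t \<in> S" for t
    using S(2,3) n by (auto simp: q_def fps_coeffs_def)
  define P where "P = A ^\<^sub>m s"
  have P: "P \<in> carrier_mat n n" using A by (simp add: P_def)
  define R where "R = (\<lambda>j. mat n n (\<lambda>(a,b). \<Sum>i<s. q (s * j + i) * (A ^\<^sub>m i) $$ (a,b)))"
  have R: "R j \<in> carrier_mat n n" for j by (simp add: R_def)
  have Apow: "A ^\<^sub>m i \<in> carrier_mat n n" and Ppow: "P ^\<^sub>m i \<in> carrier_mat n n" for i
    using A P by auto
  have one: "elements_mat (1\<^sub>m n) \<subseteq> S"
    using S(2) by (auto dest!: elements_matD)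
  define S1 where "S1 = (\<Union>i\<le>s. elements_mat (A ^\<^sub>m i))"
  define S2 where "S2 = (\<Union>j\<le>s. elements_mat (P ^\<^sub>m j))"
  define S3 where "S3 = (\<Union>j<s. elements_mat (R j))"
  define S4 where "S4 = (\<Union>j<s. elements_mat (P ^\<^sub>m j * R j))"
  have d1: "derives S (s * (n * n * (2 * n + 1))) S1"
    using derives_krylov_right[OF A one_carrier_mat S(1) one, of s] right_mult_one_mat[OF Apow]
    by (simp add: S1_def)
  have d2: "derives (S \<union> S1) (s * (n * n * (2 * n + 1))) S2"
  proof -
    have "elements_mat P \<subseteq> S \<union> S1" by (auto simp: S1_def P_def)
    then show ?thesis
      using derives_krylov_right[OF P one_carrier_mat, of "S \<union> S1" s] one right_mult_one_mat[OF Ppow]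
      by (simp add: S2_def le_supI1)
  qed
  have d3: "derives (S \<union> (S1 \<union> S2)) (card {..<s} * (n * n * (2 * s + 1))) S3"
    unfolding S3_def
  proof (intro derives_UN derives_elements_mat R)
    fix j a b assume ab: "a < n" "b < n"
    have "derives (S \<union> (S1 \<union> S2)) (0 + 0 + 1) {q (s * j + i) * (A ^\<^sub>m i) $$ (a,b)}" if "i < s" for i
    proof (intro derives_mult derives_mem)
      have "(A ^\<^sub>m i) $$ (a,b) \<in> elements_mat (A ^\<^sub>m i)"
        using ab Apow[of i] by (intro elements_matI[of _ n n a b]) auto
      then show "(A ^\<^sub>m i) $$ (a,b) \<in> S \<union> (S1 \<union> S2)" using that by (auto simp: S1_def)
    qed (use q in auto)
    then show "derives (S \<union> (S1 \<union> S2)) (2 * s + 1) {R j $$ (a,b)}"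
      unfolding R_def using ab by (simp, intro derives_sum_le[where t = 1]) auto
  qed simp
  have d4: "derives (S \<union> (S1 \<union> S2 \<union> S3)) (card {..<s} * (n * n * (2 * n + 1))) S4"
    unfolding S4_def by (intro derives_UN derives_mat_mult Ppow R) (auto simp: S2_def S3_def)
  have adj: "adj_mat A $$ (a,b) = of_int ((-1) ^ (n - 1)) * (\<Sum>j<s. (P ^\<^sub>m j * R j) $$ (a,b))"
    if ab: "a < n" "b < n" for a b
  proof -
    have "(\<Sum>t<n. fps_nth (det (rev_char_mat A)) (n - 1 - t) * (A ^\<^sub>m t) $$ (a,b))
        = (\<Sum>t<s*s. q t * (A ^\<^sub>m t) $$ (a,b))"
      using n by (intro sum.mono_neutral_cong_left) (auto simp: q_def)
    also have "\<dots> = (\<Sum>j<s. \<Sum>i<s. q (s * j + i) * (A ^\<^sub>m (s * j + i)) $$ (a,b))"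
      by (rule sum_chunks)
    also have "\<dots> = (\<Sum>j<s. (P ^\<^sub>m j * R j) $$ (a,b))"
    proof (rule sum.cong[OF refl])
      fix j
      have "(\<Sum>i<s. q (s * j + i) * (A ^\<^sub>m (s * j + i)) $$ (a,b))
          = (\<Sum>i<s. \<Sum>k<n. q (s * j + i) * ((P ^\<^sub>m j) $$ (a,k) * (A ^\<^sub>m i) $$ (k,b)))"
      proof (rule sum.cong[OF refl])
        fix i
        have "(A ^\<^sub>m (s * j + i)) $$ (a,b) = (P ^\<^sub>m j * A ^\<^sub>m i) $$ (a,b)"
          unfolding P_def pow_mat_mult[OF A] pow_mat_add[OF A] ..
        also have "\<dots> = (\<Sum>k<n. (P ^\<^sub>m j) $$ (a,k) * (A ^\<^sub>m i) $$ (k,b))"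
          using A P ab by (simp add: scalar_prod_def atLeast0LessThan)
        finally show "q (s * j + i) * (A ^\<^sub>m (s * j + i)) $$ (a,b)
            = (\<Sum>k<n. q (s * j + i) * ((P ^\<^sub>m j) $$ (a,k) * (A ^\<^sub>m i) $$ (k,b)))"
          by (simp add: sum_distrib_left)
      qed
      also have "\<dots> = (\<Sum>k<n. (P ^\<^sub>m j) $$ (a,k) * R j $$ (k,b))"
        using ab by (subst sum.swap) (simp add: R_def sum_distrib_left ac_simps)
      also have "\<dots> = (P ^\<^sub>m j * R j) $$ (a,b)"
        using R[of j] P ab by (simp add: scalar_prod_def atLeast0LessThan)
      finally show "(\<Sum>i<s. q (s * j + i) * (A ^\<^sub>m (s * j + i)) $$ (a,b)) = (P ^\<^sub>m j * R j) $$ (a,b)" .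
    qed
    finally show ?thesis using adj_mat_eq_sum_powers[OF A ab] by simp
  qed
  have d5: "derives (S \<union> (S1 \<union> S2 \<union> S3 \<union> S4)) (n * n * (s + 3)) (elements_mat (adj_mat A))"
  proof (rule derives_elements_mat[OF adj_mat(1)[OF A]])
    fix a b assume ab: "a < n" "b < n"
    have "derives (S \<union> (S1 \<union> S2 \<union> S3 \<union> S4)) (1 + (s + 1) + 1) {adj_mat A $$ (a,b)}"
      unfolding adj[OF ab]
    proof (intro derives_mult derives_of_int derives_sum_le[where t = 0])
      fix j assume "j \<in> {..<s}"
      moreover have "(P ^\<^sub>m j * R j) $$ (a,b) \<in> elements_mat (P ^\<^sub>m j * R j)"
        using Ppow[of j] R[of j] ab by (intro elements_matI[of _ n n a b]) auto
      ultimately have "(P ^\<^sub>m j * R j) $$ (a,b) \<in> S4" unfolding S4_def by blast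
      then show "derives (S \<union> (S1 \<union> S2 \<union> S3 \<union> S4)) 0 {(P ^\<^sub>m j * R j) $$ (a,b)}"
        by (intro derives_mem) blast
    qed auto
    then show "derives (S \<union> (S1 \<union> S2 \<union> S3 \<union> S4)) (s + 3) {adj_mat A $$ (a,b)}"
      by (simp add: numeral_3_eq_3)
  qed
  note d = derives_trans[OF derives_trans[OF derives_trans[OF derives_trans[OF d1 d2] d3] d4] d5]
  have "1 \<le> s * s" using s by simp
  then have n1: "2 * n + 1 \<le> 3 * (s * s)" using n by linarith
  have "s * (n * n * (2 * n + 1)) \<le> s * ((s * s) * (s * s) * (3 * (s * s)))"
    using n n1 by (intro mult_mono) auto
  also have s7: "s * ((s * s) * (s * s) * (3 * (s * s))) = 3 * s ^ 7" by (simp add: power_numeral_reduce)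
  finally have c1: "s * (n * n * (2 * n + 1)) \<le> 3 * s ^ 7" .
  have "s * (n * n * (2 * s + 1)) \<le> s * ((s * s) * (s * s) * (3 * (s * s)))"
  proof -
    have "2 * s + 1 \<le> 3 * s" using s by simp
    also have "\<dots> \<le> 3 * (s * s)" using s by simp
    finally have "2 * s + 1 \<le> 3 * (s * s)" .
    then show ?thesis using n by (intro mult_mono) auto
  qed
  also note s7
  finally have c3: "s * (n * n * (2 * s + 1)) \<le> 3 * s ^ 7" .
  have "n * n * (s + 3) \<le> (s * s) * (s * s) * (4 * s)" using n s by (intro mult_mono) auto
  also have "\<dots> = 4 * s ^ 5" by (simp add: power_numeral_reduce)
  also have "s ^ 5 \<le> s ^ 7" using s by (intro power_increasing) auto
  finally have c5: "n * n * (s + 3) \<le> 4 * s ^ 7" by simp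
  \<comment> \<open>In units of \<open>s ^ 7\<close>: 3 each for the powers of \<open>A\<close>, the
    powers of \<open>P\<close>, the \<open>R j\<close> and the products, 4 for the final sums with
    sign.\<close>
  have "s * (n * n * (2 * n + 1)) + s * (n * n * (2 * n + 1)) + card {..<s} * (n * n * (2 * s + 1)) +
      card {..<s} * (n * n * (2 * n + 1)) + n * n * (s + 3) \<le> 16 * s ^ 7"
    unfolding card_lessThan using c1 c3 c5 by linarith
  then show ?thesis by (intro derives_mono[OF d]) auto
qed

lemma derives_adj_mat:
  fixes A :: "'a :: comm_ring_1 mat"
  assumes A: "A \<in> carrier_mat n n" and n: "n \<le> 4 ^ e"
  shows "derives (elements_mat A) (77 * 2 ^ 40 * (e + 1) ^ 11 * (2 ^ e) ^ 7) (elements_mat (adj_mat A))"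
proof -
  define s :: nat where "s = 2 ^ e"
  define r where "r = 2 ^ 40 * s * (e + 1) ^ 10"
  have rank: "mult_rank s r" unfolding s_def r_def by (rule mult_rank_pow2)
  have s0: "0 < s" by (simp add: s_def)
  have sr: "s \<le> r" by (simp add: r_def)
  have n': "n \<le> s * s" using n by (simp add: s_def flip: power_mult_distrib)
  let ?S = "elements_mat A" and ?Q = "fps_coeffs (s * s) (det (rev_char_mat A))"
  have d1: "derives ?S 2 {0,1}"
  proof -
    have "derives ?S (1 + 1) ({of_int 0} \<union> {of_int 1})" by (intro derives_Un derives_of_int)
    then show ?thesis by (rule derives_mono) auto
  qed
  have d2: "derives (?S \<union> {0,1}) ((3 * e + 59) * (r * s ^ 6)) ?Q"
    using A n' by (intro derives_det_rev_char_mat rank s_def sr) auto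
  have d3: "derives (?S \<union> ({0,1} \<union> ?Q)) (16 * s ^ 7) (elements_mat (adj_mat A))"
    using A n' s0 by (intro derives_adj_mat_from_det) auto
  note d = derives_trans[OF derives_trans[OF d1 d2] d3]
  have s7: "s ^ 7 \<le> r * s ^ 6" using sr by (simp add: power_numeral_reduce)
  have "1 \<le> s ^ 7" using s0 by simp
  \<comment> \<open>The 18 added to 59 is 2 for the constants 0 and 1 and 16 for the adjoint. Of the
    exponent 11, 10 comes from the rank and 1 from repeated squaring.\<close>
  then have "2 + (3 * e + 59) * (r * s ^ 6) + 16 * s ^ 7 \<le> (3 * e + 59) * (r * s ^ 6) + 18 * (r * s ^ 6)"
    using s7 by linarith
  also have "\<dots> = (3 * e + 77) * (r * s ^ 6)" by (simp add: algebra_simps)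
  also have "\<dots> \<le> (77 * (e + 1)) * (r * s ^ 6)" by (intro mult_right_mono) auto
  also have "\<dots> = 77 * 2 ^ 40 * (e + 1) ^ 11 * s ^ 7"
  proof -
    have "(e + 1) ^ 11 = (e + 1) * (e + 1) ^ 10" "s ^ 7 = s * s ^ 6"
      by (simp_all only: power_Suc[symmetric]) simp_all
    then show ?thesis by (simp only: r_def ac_simps)
  qed
  finally show ?thesis unfolding s_def by (intro derives_mono[OF d]) (auto simp: s_def)
qed

section \<open>Straight-line programs\<close>

lemma slp_exec_Cons: "slp_exec (i # prog) vs = slp_exec prog (vs @ [slp_step vs i])"
  by (simp add: slp_exec_def)

lemma slp_wf_Cons: "slp_wf k (i # prog) \<longleftrightarrow> instr_wf k i \<and> slp_wf (Suc k) prog"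
  unfolding slp_wf_def by (auto simp: less_Suc_eq_0_disj)

lemma length_slp_exec: "length (slp_exec prog vs) = length vs + length prog"
  by (induction prog arbitrary: vs) (simp_all add: slp_exec_Cons, simp add: slp_exec_def)

text \<open>Derivations speak of values, programs of registers; whichever register holds an operand
  may be used, and the list of registers only grows.\<close>

lemma derives_imp_slp:
  assumes "derives S t T" "S = set vs"
  shows "\<exists>prog. length prog \<le> t \<and> slp_wf (length vs) prog \<and> T \<subseteq> set (slp_exec prog vs)"
proof -
  have Cons: "\<exists>prog. length prog \<le> t \<and> slp_wf (length vs) prog \<and> T \<subseteq> set (slp_exec prog vs)"
    if "slp_wf (length vs) [i]" "length prog \<le> t'" "t = Suc t'"
    "slp_wf (length (vs @ [slp_step vs i])) prog" "T \<subseteq> set (slp_exec prog (vs @ [slp_step vs i]))"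
    for i prog t t' T and vs :: "'a list"
    using that by (intro exI[of _ "i # prog"]) (auto simp: slp_exec_Cons slp_wf_Cons)
  show ?thesis using assms
  proof (induction arbitrary: vs rule: derives.induct)
    case (derives_refl T S t)
    then show ?case by (intro exI[of _ "[]"]) (auto simp: slp_exec_def slp_wf_def)
  next
    case (derives_add_step x S y t T)
    obtain i j where ij: "i < length vs" "j < length vs" "x = vs ! i" "y = vs ! j"
      using derives_add_step by (metis in_set_conv_nth)
    then show ?case
      using derives_add_step.IH[of "vs @ [slp_step vs (SAdd i j)]"] derives_add_step.prems Cons[of vs "SAdd i j"]
      by (auto simp: slp_wf_def)
  next
    case (derives_diff_step x S y t T)
    obtain i j where ij: "i < length vs" "j < length vs" "x = vs ! i" "y = vs ! j"
      using derives_diff_step by (metis in_set_conv_nth)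
    then show ?case
      using derives_diff_step.IH[of "vs @ [slp_step vs (SSub i j)]"] derives_diff_step.prems Cons[of vs "SSub i j"]
      by (auto simp: slp_wf_def)
  next
    case (derives_mult_step x S y t T)
    obtain i j where ij: "i < length vs" "j < length vs" "x = vs ! i" "y = vs ! j"
      using derives_mult_step by (metis in_set_conv_nth)
    then show ?case
      using derives_mult_step.IH[of "vs @ [slp_step vs (SMul i j)]"] derives_mult_step.prems Cons[of vs "SMul i j"]
      by (auto simp: slp_wf_def)
  next
    case (derives_of_int_step c S t T)
    then show ?case
      using derives_of_int_step.IH[of "vs @ [slp_step vs (SConst c)]"] Cons[of vs "SConst c"]
      by (auto simp: slp_wf_def)
  qed
qed

section \<open>Evaluating functions on matrices at a point\<close>

lemma of_int_fun_apply: "(of_int c :: 'x \<Rightarrow> 'a :: ring_1) x = of_int c"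
  by (cases c rule: int_cases2) simp_all

text \<open>Evaluation at \<open>x\<close> is a ring homomorphism, so it commutes with each
  instruction; well-formedness keeps indices in range, where \<open>map\<close> commutes with
  \<open>!\<close>.\<close>

lemma slp_exec_apply:
  fixes vs :: "('x \<Rightarrow> 'a :: comm_ring_1) list"
  assumes "slp_wf (length vs) prog"
  shows "slp_exec prog (map (\<lambda>f. f x) vs) = map (\<lambda>f. f x) (slp_exec prog vs)"
  using assms
proof (induction prog arbitrary: vs)
  case Nil
  then show ?case by (simp add: slp_exec_def)
next
  case (Cons i prog)
  then have "slp_step (map (\<lambda>f. f x) vs) i = slp_step vs i x"
    by (cases i) (auto simp: slp_wf_Cons of_int_fun_apply)
  then show ?case using Cons.IH[of "vs @ [slp_step vs i]"] Cons.prems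
    by (simp add: slp_exec_Cons slp_wf_Cons)
qed

lemma adj_mat_apply:
  fixes G :: "('x \<Rightarrow> 'a :: comm_ring_1) mat"
  assumes G: "G \<in> carrier_mat n n" and ij: "i < n" "j < n"
  shows "(adj_mat G $$ (i,j)) x = adj_mat (map_mat (\<lambda>f. f x) G) $$ (i,j)"
proof -
  interpret ev: comm_ring_hom "\<lambda>f :: 'x \<Rightarrow> 'a. f x" by unfold_locales auto
  have "mat_delete (map_mat (\<lambda>f. f x) G) j i = map_mat (\<lambda>f. f x) (mat_delete G j i)"
    by (intro eq_matI) (auto simp: mat_delete_def)
  then show ?thesis using G ij
    by (simp add: adj_mat_def cofactor_def ev.hom_mult ev.hom_power ev.hom_uminus)
qed

text \<open>The straight-line program is found for the generic matrix, whose entries are the coordinate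
  functions in the ring of functions on matrices, and then evaluated pointwise.\<close>

lemma slp_computes_adj_exists:
  assumes "n \<le> 4 ^ e"
  shows "\<exists>prog out. slp_computes_adj n prog out TYPE('a :: comm_ring_1) \<and>
    length prog \<le> 77 * 2 ^ 40 * (e + 1) ^ 11 * (2 ^ e) ^ 7"
proof -
  define vs :: "('a mat \<Rightarrow> 'a) list" where "vs = map (\<lambda>k A. A $$ (k div n, k mod n)) [0..<n * n]"
  \<comment> \<open>A derivation concerns one fixed matrix, but the program must not depend on the
    input; an identity between functions on matrices holds at every matrix at once.\<close>
  define G :: "('a mat \<Rightarrow> 'a) mat" where "G = mat n n (\<lambda>(i,j) A. A $$ (i,j))"
  have G: "G \<in> carrier_mat n n" by (simp add: G_def)
  have "elements_mat G \<subseteq> set vs"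
  proof
    fix f assume "f \<in> elements_mat G"
    then obtain i j where ij: "i < n" "j < n" "f = (\<lambda>A. A $$ (i,j))"
      by (auto simp: G_def dest!: elements_matD)
    have "i * n + j < n * n"
    proof -
      have "i * n + j < Suc i * n" using ij by simp
      also have "\<dots> \<le> n * n" using ij by (intro mult_right_mono) auto
      finally show ?thesis .
    qed
    then show "f \<in> set vs" using ij by (auto simp: vs_def intro!: image_eqI[of _ _ "i * n + j"])
  qed
  then have "derives (set vs) (77 * 2 ^ 40 * (e + 1) ^ 11 * (2 ^ e) ^ 7) (elements_mat (adj_mat G))"
    by (rule derives_mono[OF derives_adj_mat[OF G assms]]) auto
  from derives_imp_slp[OF this refl] obtain prog where
    len: "length prog \<le> 77 * 2 ^ 40 * (e + 1) ^ 11 * (2 ^ e) ^ 7" and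
    wf: "slp_wf (length vs) prog" and sub: "elements_mat (adj_mat G) \<subseteq> set (slp_exec prog vs)"
    by blast
  have lvs: "length vs = n * n" by (simp add: vs_def)
  have "\<forall>i j. \<exists>k. i < n \<longrightarrow> j < n \<longrightarrow> k < n * n + length prog \<and> slp_exec prog vs ! k = adj_mat G $$ (i,j)"
  proof (intro allI)
    fix i j
    show "\<exists>k. i < n \<longrightarrow> j < n \<longrightarrow> k < n * n + length prog \<and> slp_exec prog vs ! k = adj_mat G $$ (i,j)"
    proof (cases "i < n \<and> j < n")
      case True
      then have "adj_mat G $$ (i,j) \<in> set (slp_exec prog vs)"
        using sub adj_mat(1)[OF G] by (auto intro: elements_matI)
      then show ?thesis by (auto simp: in_set_conv_nth length_slp_exec lvs)
    qed auto
  qed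
  then obtain out where out: "\<And>i j. i < n \<Longrightarrow> j < n \<Longrightarrow>
      out i j < n * n + length prog \<and> slp_exec prog vs ! out i j = adj_mat G $$ (i,j)"
    by metis
  have "slp_exec prog (mat_inputs n A) ! out i j = adj_mat A $$ (i,j)"
    if A: "A \<in> carrier_mat n n" and ij: "i < n" "j < n" for A :: "'a mat" and i j
  proof -
    have "mat_inputs n A = map (\<lambda>f. f A) vs" by (simp add: mat_inputs_def vs_def)
    then have "slp_exec prog (mat_inputs n A) ! out i j = (adj_mat G $$ (i,j)) A"
      using slp_exec_apply[OF wf, of A] out[OF ij] by (simp add: length_slp_exec lvs)
    also have "\<dots> = adj_mat (map_mat (\<lambda>f. f A) G) $$ (i,j)"
      by (rule adj_mat_apply[OF G ij])
    also have "map_mat (\<lambda>f. f A) G = A" using A by (intro eq_matI) (auto simp: G_def)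
    finally show ?thesis .
  qed
  then have "slp_computes_adj n prog out TYPE('a)"
    unfolding slp_computes_adj_def using wf out lvs by auto
  with len show ?thesis by blast
qed

section \<open>The asymptotic bound\<close>

theorem theorem3:
  shows "\<exists>C \<beta> N. C > 0 \<and> \<beta> > 0 \<and>
    (\<forall>n \<ge> N. \<exists>prog out. slp_computes_adj n prog out TYPE('a :: comm_ring_1) \<and>
        real (length prog) \<le> C * real n ^ 3 * sqrt (real n) * ln (real n) powr \<beta>)"
proof -
  define c :: real where "c = 77 * 2 ^ 40"
  have "\<exists>prog out. slp_computes_adj n prog out TYPE('a) \<and>
      real (length prog) \<le> (c * 3 ^ 11 * 2 ^ 7) * real n ^ 3 * sqrt (real n) * ln (real n) powr 11"
    if n: "n \<ge> 3" for n :: nat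
  proof -
    \<comment> \<open>Minimality gives \<open>4 ^ (e - 1) < n\<close>, so the block size
      \<open>2 ^ e\<close> exceeds sqrt(n) by a factor of at most 2.\<close>
    define e where "e = (LEAST e. n \<le> 4 ^ e)"
    have "n \<le> 4 ^ n" by (rule order.strict_implies_order[OF power_gt_expt]) simp
    then have e: "n \<le> 4 ^ e" unfolding e_def by (rule LeastI)
    have "e \<noteq> 0" using e n by (cases e) auto
    then obtain d where d: "e = Suc d" by (cases e) auto
    have "\<not> n \<le> 4 ^ d" using not_less_Least[of d "\<lambda>e. n \<le> 4 ^ e"] d by (simp add: e_def)
    then have "real (4 ^ d) \<le> real n" by (intro of_nat_mono) simp
    then have d4: "4 ^ d \<le> real n" by simp
    \<comment> \<open>The threshold 3 makes ln n at least 1, so the constant in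
      \<open>e + 1 = d + 2\<close> is absorbed by \<open>3 * ln n\<close>.\<close>
    have "exp 1 \<le> real n" using exp_le n by linarith
    then have ln1: "1 \<le> ln (real n)" using n by (subst ln_ge_iff) auto
    have "real d \<le> ln (real n)"
    proof -
      have "exp (real d) = exp 1 ^ d" by (simp add: exp_of_nat_mult[symmetric])
      also have "\<dots> \<le> 4 ^ d" using exp_le by (intro power_mono) auto
      also note d4
      finally show ?thesis using n by (subst ln_ge_iff) auto
    qed
    then have e_ln: "real (e + 1) \<le> 3 * ln (real n)" using d ln1 by simp
    have "2 ^ d = sqrt (4 ^ d)"
      by (rule real_sqrt_unique[symmetric]) (simp_all flip: power_mult_distrib add: power2_eq_square)
    also have "\<dots> \<le> sqrt (real n)" using d4 by simp
    finally have "2 ^ e \<le> 2 * sqrt (real n)" using d by simp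
    then have "(2 ^ e) ^ 7 \<le> (2 * sqrt (real n)) ^ 7" by (intro power_mono) auto
    also have "\<dots> = 2 ^ 7 * (real n ^ 3 * sqrt (real n))"
    proof -
      have "sqrt (real n) ^ 7 = (sqrt (real n) ^ 2) ^ 3 * sqrt (real n)"
        by (simp add: power_numeral_reduce)
      then show ?thesis by (simp only: power_mult_distrib) simp
    qed
    finally have s7: "(2 ^ e) ^ 7 \<le> 2 ^ 7 * (real n ^ 3 * sqrt (real n))" .
    have "real (e + 1) ^ 11 \<le> (3 * ln (real n)) ^ 11" using e_ln by (intro power_mono) auto
    also have "\<dots> = 3 ^ 11 * ln (real n) powr 11"
      using ln1 by (simp add: power_mult_distrib powr_numeral)
    finally have e11: "real (e + 1) ^ 11 \<le> 3 ^ 11 * ln (real n) powr 11" .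
    obtain prog out where po: "slp_computes_adj n prog out TYPE('a)"
      "length prog \<le> 77 * 2 ^ 40 * (e + 1) ^ 11 * (2 ^ e) ^ 7"
      using slp_computes_adj_exists[OF e] by blast
    have "real (length prog) \<le> real (77 * 2 ^ 40 * (e + 1) ^ 11 * (2 ^ e) ^ 7)"
      by (rule of_nat_mono[OF po(2)])
    also have "\<dots> = c * real (e + 1) ^ 11 * (2 ^ e) ^ 7"
      unfolding c_def by (simp only: of_nat_mult of_nat_power of_nat_numeral)
    also have "\<dots> \<le> c * (3 ^ 11 * ln (real n) powr 11) * (2 ^ 7 * (real n ^ 3 * sqrt (real n)))"
      using e11 s7 by (intro mult_mono) (auto simp: c_def)
    also have "\<dots> = (c * 3 ^ 11 * 2 ^ 7) * real n ^ 3 * sqrt (real n) * ln (real n) powr 11"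
      by (simp only: ac_simps)
    finally show ?thesis using po(1) by blast
  qed
  moreover have "c * 3 ^ 11 * 2 ^ 7 > 0" by (simp add: c_def)
  ultimately show ?thesis
    by (intro exI[of _ "c * 3 ^ 11 * 2 ^ 7"] exI[of _ 11] exI[of _ 3]) simp
qed

end
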